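(* Let $q\in L^1_{\mathrm{loc}}(\mathbb R)$ with $\rho(D(q))\neq\emptyset$, and let $z\in\rho(D(q))$. Then there exist two linearly independent $z$-wave functions $\Psi_-(z,\cdot)$, $\Psi_+(z,\cdot)$ associated with $q$, each unique up to constant multiples, such that for all $R\in\mathbb R$: $\Psi_-(z,\cdot)\in L^2((-\infty,R])^2$, $\Psi_+(z,\cdot)\in L^2([R,\infty))^2$; $\|\Psi_-(z,\cdot)\|_{\mathbb C^2}^{-1}\in L^2([R,\infty))$, $\|\Psi_+(z,\cdot)\|_{\mathbb C^2}^{-1}\in L^2((-\infty,R])$; $\lim_{x\to\pm\infty}\|\Psi_\pm(z,x)\|_{\mathbb C^2}=\lim_{x\to\mp\infty}\|\Psi_\pm(z,x)\|_{\mathbb C^2}^{-1}=0$; and $$\sup_{r\in\mathbb R}\Big(\int_{-\infty}^r\|\Psi_-(z,x)\|_{\mathbb C^2}^2dx\Big)\Big(\int_r^\infty\|\Psi_+(z,x)\|_{\mathbb C^2}^2dx\Big)<\infty.$$ Moreover, the $\overline z$-wave functions $\mathcal K\Psi_\pm(z,\cdot)$ satisfy the same properties with $z$ replaced by $\overline z$.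
   Context: Let $q\in L^1_{\mathrm{loc}}(\mathbb R)$. For $z\in\mathbb C$, a $z$-wave function associated with $q$ is a function $\Psi(z,\cdot)=(\psi_1(z,\cdot),\psi_2(z,\cdot))^\top\in AC_{\mathrm{loc}}(\mathbb R)^2$, not identically zero, with $\psi_1'=-iz\psi_1+q\psi_2$, $\psi_2'=iz\psi_2-\overline{q}\psi_1$ a.e.; equivalently $M(q)\Psi=z\Psi$ with $M(q)=i\begin{pmatrix}\frac{d}{dx}&-q\\-\overline q&-\frac{d}{dx}\end{pmatrix}$. $D(q)$ is the maximal operator in $L^2(\mathbb R)^2$: $D(q)F=M(q)F$ on $\{F\in L^2(\mathbb R)^2: F\in AC_{\mathrm{loc}}(\mathbb R)^2,\ M(q)F\in L^2(\mathbb R)^2\}$. $\mathcal K(a,b)^\top=(\overline b,-\overline a)^\top$ (applied pointwise). *)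

theory Defs
  imports "HOL-Analysis.Analysis"
begin

type_synonym C2fun = "real \<Rightarrow> complex \<times> complex"

definition cscale :: "complex \<Rightarrow> complex \<times> complex \<Rightarrow> complex \<times> complex" where
  "cscale c v = (c * fst v, c * snd v)"

definition Kop :: "complex \<times> complex \<Rightarrow> complex \<times> complex" where
  "Kop v = (cnj (snd v), - cnj (fst v))"

definition L1_loc :: "(real \<Rightarrow> complex) \<Rightarrow> bool" where
  "L1_loc q \<longleftrightarrow> (\<forall>a b. set_integrable lborel {a..b} q)"

definition abs_cont_on :: "real \<Rightarrow> real \<Rightarrow> (real \<Rightarrow> 'a::real_normed_vector) \<Rightarrow> bool" where
  "abs_cont_on s t F \<longleftrightarrow>
     (\<forall>e>0. \<exists>d>0. \<forall>(n::nat) (a::nat\<Rightarrow>real) b.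
        (\<forall>k<n. s \<le> a k \<and> a k \<le> b k \<and> b k \<le> t) \<and>
        (\<forall>j<n. \<forall>k<n. j \<noteq> k \<longrightarrow> b j \<le> a k \<or> b k \<le> a j) \<and>
        (\<Sum>k<n. b k - a k) < d
        \<longrightarrow> (\<Sum>k<n. norm (F (b k) - F (a k))) < e)"

definition AC_loc :: "(real \<Rightarrow> 'a::real_normed_vector) \<Rightarrow> bool" where
  "AC_loc F \<longleftrightarrow> (\<forall>s t. abs_cont_on s t F)"

text \<open>The differential expression M(q) applied at x to a value v with derivative v':
  M(q) = i [[d/dx, -q], [-conj q, -d/dx]].\<close>
definition Mq :: "(real \<Rightarrow> complex) \<Rightarrow> real \<Rightarrow> complex \<times> complex \<Rightarrow> complex \<times> complex
                   \<Rightarrow> complex \<times> complex" where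
  "Mq q x v v' = (\<i> * (fst v' - q x * snd v), \<i> * (- cnj (q x) * fst v - snd v'))"

definition wave_function :: "(real \<Rightarrow> complex) \<Rightarrow> complex \<Rightarrow> C2fun \<Rightarrow> bool" where
  "wave_function q z \<Psi> \<longleftrightarrow> AC_loc \<Psi> \<and> (\<exists>x. \<Psi> x \<noteq> 0) \<and>
     (AE x in lborel. (\<Psi> has_vector_derivative
        (- \<i> * z * fst (\<Psi> x) + q x * snd (\<Psi> x),
         \<i> * z * snd (\<Psi> x) - cnj (q x) * fst (\<Psi> x))) (at x))"

definition L2_on :: "real set \<Rightarrow> C2fun \<Rightarrow> bool" where
  "L2_on S F \<longleftrightarrow> set_borel_measurable lborel S F \<and>
                 set_integrable lborel S (\<lambda>x. (norm (F x))\<^sup>2)"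

definition L2norm :: "C2fun \<Rightarrow> real" where
  "L2norm F = sqrt (LINT x|lborel. (norm (F x))\<^sup>2)"

text \<open>Graph of the maximal operator D(q): F in the domain and D(q) F = G (in L^2, a.e.).\<close>
definition Dq_graph :: "(real \<Rightarrow> complex) \<Rightarrow> C2fun \<Rightarrow> C2fun \<Rightarrow> bool" where
  "Dq_graph q F G \<longleftrightarrow> L2_on UNIV F \<and> AC_loc F \<and> L2_on UNIV G \<and>
     (AE x in lborel. \<exists>F'. (F has_vector_derivative F') (at x) \<and> G x = Mq q x (F x) F')"

definition resolvent_set_Dq :: "(real \<Rightarrow> complex) \<Rightarrow> complex set" where
  "resolvent_set_Dq q = {z.
     (\<forall>G. L2_on UNIV G \<longrightarrow>
        (\<exists>F. Dq_graph q F (\<lambda>x. G x + cscale z (F x)))) \<and>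
     (\<forall>F. Dq_graph q F (\<lambda>x. cscale z (F x)) \<longrightarrow> (AE x in lborel. F x = 0)) \<and>
     (\<exists>C. \<forall>F G. Dq_graph q F G \<longrightarrow>
        L2norm F \<le> C * L2norm (\<lambda>x. G x - cscale z (F x)))}"

definition weyl_pair :: "(real \<Rightarrow> complex) \<Rightarrow> complex \<Rightarrow> C2fun \<Rightarrow> C2fun \<Rightarrow> bool" where
  "weyl_pair q z \<Psi>m \<Psi>p \<longleftrightarrow>
     wave_function q z \<Psi>m \<and> wave_function q z \<Psi>p \<and>
     (\<forall>a b. (\<forall>x. a * fst (\<Psi>m x) + b * fst (\<Psi>p x) = 0 \<and>
                  a * snd (\<Psi>m x) + b * snd (\<Psi>p x) = 0) \<longrightarrow> a = 0 \<and> b = 0) \<and>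
     (\<forall>\<Phi>. wave_function q z \<Phi> \<and> (\<forall>R. L2_on {..R} \<Phi>) \<longrightarrow>
        (\<exists>c. \<forall>x. \<Phi> x = cscale c (\<Psi>m x))) \<and>
     (\<forall>\<Phi>. wave_function q z \<Phi> \<and> (\<forall>R. L2_on {R..} \<Phi>) \<longrightarrow>
        (\<exists>c. \<forall>x. \<Phi> x = cscale c (\<Psi>p x))) \<and>
     (\<forall>R. L2_on {..R} \<Psi>m \<and> L2_on {R..} \<Psi>p) \<and>
     (\<forall>R. set_integrable lborel {R..} (\<lambda>x. (inverse (norm (\<Psi>m x)))\<^sup>2) \<and>
          set_integrable lborel {..R} (\<lambda>x. (inverse (norm (\<Psi>p x)))\<^sup>2)) \<and>
     ((\<lambda>x. norm (\<Psi>p x)) \<longlongrightarrow> 0) at_top \<and>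
     ((\<lambda>x. inverse (norm (\<Psi>p x))) \<longlongrightarrow> 0) at_bot \<and>
     ((\<lambda>x. norm (\<Psi>m x)) \<longlongrightarrow> 0) at_bot \<and>
     ((\<lambda>x. inverse (norm (\<Psi>m x))) \<longlongrightarrow> 0) at_top \<and>
     (\<exists>C. \<forall>r. (LINT x:{..r}|lborel. (norm (\<Psi>m x))\<^sup>2) *
               (LINT x:{r..}|lborel. (norm (\<Psi>p x))\<^sup>2) \<le> C)"

end

(*
The squared norm of a z-wave function has logarithmic derivative bounded by 2 |Im z|, so a wave
function that is square integrable at one end tends to zero there; as the Wronskian of two wave
functions is constant, at each end the square integrable ones form a space of dimension at most one.
Let Phi be a wave function and F = (D(q) - z)^{-1} G, where G is the restriction to [a,b] of
(conj phi_2, conj phi_1). Green's formula says that the Wronskian of Phi and F grows by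
i int_a^b |Phi|^2 from a to b, while F is an L^2 wave function on either side of [a,b]. This forces
nonzero L^2 wave functions Psi_- and Psi_+ at the two ends. They are not proportional, since z
is not an eigenvalue, so their Wronskian W is nonzero and 1/|Psi_-| <= |Psi_+|/|W|, and conversely.
For Phi = Psi_- and b = r one gets F = c Psi_+ on [r,infinity) with |c W| = int_a^r |Psi_-|^2,
so boundedness of the resolvent bounds the product of the two integrals. Finally K preserves norms
and conjugates Wronskians.
*)
theory Submission
  imports Defs
begin

section \<open>Absolutely continuous functions\<close>

text \<open>The system holds only almost everywhere and \<open>q\<close> is merely locally
  integrable, so classical calculus does not apply: absolute continuity is first tied to integration
  in both directions, and solutions come from a Picard iteration measured by the primitive of the
  coefficient bound. Uniqueness for initial values is then read off from constant Wronskians with a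
  fundamental system instead of a Gronwall estimate. D(q) is in general not self-adjoint, so
  arguments with Weyl discs are not at hand. The Wronskian is therefore kept bilinear: both
  functions in Green's formula belong to the same \<open>z\<close>, and it is the conjugation inside
  the source that produces the mass of \<Phi>. The source lives on a compact interval because a
  general \<Phi> has finite mass only there, and because the response is then a genuine solution
  near each end, where decay disposes of the boundary term. The resulting bound does not depend on
  the left endpoint of the source, which is sent to minus infinity only at the very end.\<close>

lemma abs_cont_on_family:
  assumes "abs_cont_on s t F" "e > 0"
  shows "\<exists>d>0. \<forall>(I::'i set) a b. finite I \<and> (\<forall>k\<in>I. s \<le> a k \<and> a k \<le> b k \<and> b k \<le> t) \<and>
       (\<forall>j\<in>I. \<forall>k\<in>I. j \<noteq> k \<longrightarrow> b j \<le> a k \<or> b k \<le> a j) \<and> (\<Sum>k\<in>I. b k - a k) < d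
       \<longrightarrow> (\<Sum>k\<in>I. norm (F (b k) - F (a k))) < e"
proof -
  have "\<exists>d>0. \<forall>(n::nat) (a::nat\<Rightarrow>real) b.
        (\<forall>k<n. s \<le> a k \<and> a k \<le> b k \<and> b k \<le> t) \<and>
        (\<forall>j<n. \<forall>k<n. j \<noteq> k \<longrightarrow> b j \<le> a k \<or> b k \<le> a j) \<and>
        (\<Sum>k<n. b k - a k) < d
        \<longrightarrow> (\<Sum>k<n. norm (F (b k) - F (a k))) < e"
    using assms unfolding abs_cont_on_def by simp
  then obtain d where "d > 0" and d: "\<forall>(n::nat) (a::nat\<Rightarrow>real) b.
        (\<forall>k<n. s \<le> a k \<and> a k \<le> b k \<and> b k \<le> t) \<and>
        (\<forall>j<n. \<forall>k<n. j \<noteq> k \<longrightarrow> b j \<le> a k \<or> b k \<le> a j) \<and>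
        (\<Sum>k<n. b k - a k) < d
        \<longrightarrow> (\<Sum>k<n. norm (F (b k) - F (a k))) < e"
    by (elim exE conjE) (rule that; assumption)
  show ?thesis
  proof (intro exI[of _ d] conjI allI impI \<open>d > 0\<close>; elim conjE)
    fix I :: "'i set" and a b
    assume I: "finite I" and ab: "\<forall>k\<in>I. s \<le> a k \<and> a k \<le> b k \<and> b k \<le> t"
      and dis: "\<forall>j\<in>I. \<forall>k\<in>I. j \<noteq> k \<longrightarrow> b j \<le> a k \<or> b k \<le> a j"
      and len: "(\<Sum>k\<in>I. b k - a k) < d"
    \<comment> \<open>Absolute continuity is defined for intervals numbered by naturals, whereas the
      pieces of a tagged division are indexed by the division itself; an enumeration of
      \<open>I\<close> bridges the two.\<close>
    obtain h where h: "bij_betw h {..<card I} I"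
      using ex_bij_betw_nat_finite[OF I] by (auto simp: atLeast0LessThan)
    have hI: "h k \<in> I" if "k < card I" for k
      using h that by (auto simp: bij_betw_def)
    have hne: "h j \<noteq> h k" if "j < card I" "k < card I" "j \<noteq> k" for j k
      using h that by (auto simp: bij_betw_def inj_on_def)
    have "(\<Sum>k<card I. norm (F ((b \<circ> h) k) - F ((a \<circ> h) k))) < e"
    proof (rule d[rule_format], intro conjI)
      show "(\<Sum>k<card I. (b \<circ> h) k - (a \<circ> h) k) < d"
        using len sum.reindex_bij_betw[OF h, of "\<lambda>k. b k - a k"] by simp
    qed (use ab dis hI hne in auto)
    then show "(\<Sum>k\<in>I. norm (F (b k) - F (a k))) < e"
      using sum.reindex_bij_betw[OF h, of "\<lambda>k. norm (F (b k) - F (a k))"] by simp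
  qed
qed

text \<open>A gauge argument: pieces tagged outside \<open>N\<close> have small error by
  differentiability, and pieces tagged in \<open>N\<close> lie in an open set of small measure, so
  absolute continuity makes their increments small in total. Integrability of \<open>f\<close> comes
  out together with the value of the integral.\<close>

theorem abs_cont_on_has_integral:
  fixes F :: "real \<Rightarrow> 'a::banach"
  assumes "s \<le> t" and AC: "abs_cont_on s t F" and N: "negligible N"
    and der: "\<And>x. x \<in> {s..t} - N \<Longrightarrow> (F has_vector_derivative f x) (at x)"
  shows "(f has_integral (F t - F s)) {s..t}"
proof (rule has_integral_spike[OF N])
  \<comment> \<open>With the value 0 on \<open>N\<close>, a piece tagged in \<open>N\<close>
    contributes nothing but its increment of \<open>F\<close>.\<close>
  define g where "g = (\<lambda>x. if x \<in> N then 0 else f x)"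
  show "\<And>x. x \<in> {s..t} - N \<Longrightarrow> f x = g x"
    by (simp add: g_def)
  show "(g has_integral (F t - F s)) {s..t}"
    unfolding has_integral_real
  proof (intro allI impI)
    fix e :: real
    assume "e > 0"
    \<comment> \<open>The pieces tagged outside \<open>N\<close> then err by at most
      \<open>e' * (t - s)\<close>, which is below \<open>e / 2\<close>; the summand 1 covers the
      case \<open>s = t\<close>.\<close>
    define e' where "e' = e / (2 * (t - s + 1))"
    have "e' > 0" using \<open>e > 0\<close> \<open>s \<le> t\<close> by (simp add: e'_def)
    have e't: "e' * (t - s) < e / 2"
      using \<open>e > 0\<close> \<open>s \<le> t\<close> by (simp add: e'_def field_simps)
    have "\<forall>x. \<exists>d>0. x \<in> {s..t} - N \<longrightarrow>
           (\<forall>y. norm (y-x) < d \<longrightarrow> norm (F y - F x - (y-x) *\<^sub>R g x) \<le> e' * norm (y-x))"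
    proof
      fix x
      show "\<exists>d>0. x \<in> {s..t} - N \<longrightarrow>
           (\<forall>y. norm (y-x) < d \<longrightarrow> norm (F y - F x - (y-x) *\<^sub>R g x) \<le> e' * norm (y-x))"
      proof (cases "x \<in> {s..t} - N")
        case True
        then show ?thesis
          using der[OF True] \<open>e' > 0\<close>
          unfolding has_vector_derivative_def has_derivative_within_alt g_def by auto
      qed (use zero_less_one in blast)
    qed
    then obtain r where r: "\<And>x. 0 < r x"
       "\<And>x y. \<lbrakk>x \<in> {s..t} - N; norm (y-x) < r x\<rbrakk>
              \<Longrightarrow> norm (F y - F x - (y-x) *\<^sub>R g x) \<le> e' * norm (y-x)"
      by metis
    obtain d where "d > 0" and d: "\<forall>(I::(real \<times> real set) set) a b. finite I \<and> (\<forall>k\<in>I. s \<le> a k \<and> a k \<le> b k \<and> b k \<le> t) \<and>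
       (\<forall>j\<in>I. \<forall>k\<in>I. j \<noteq> k \<longrightarrow> b j \<le> a k \<or> b k \<le> a j) \<and> (\<Sum>k\<in>I. b k - a k) < d
       \<longrightarrow> (\<Sum>k\<in>I. norm (F (b k) - F (a k))) < e / 2"
      using abs_cont_on_family[OF AC half_gt_zero[OF \<open>e > 0\<close>]] by (elim exE conjE) (rule that; assumption)
    have Nleb: "N \<in> null_sets lebesgue" using N by (simp add: negligible_iff_null_sets)
    obtain U where U: "open U" "N \<subseteq> U" "U - N \<in> lmeasurable" "emeasure lebesgue (U - N) < ennreal d"
      using sets_lebesgue_outer_open[of N d] Nleb \<open>d > 0\<close> by blast
    have mU: "emeasure lborel U < ennreal d"
    proof -
      have "emeasure lebesgue U = emeasure lebesgue (U - N)"
        using emeasure_Diff_null_set[OF Nleb, of U] U(1) by auto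
      then show ?thesis using U by simp
    qed
    have "\<forall>x. \<exists>\<rho>>0. x \<in> N \<longrightarrow> ball x \<rho> \<subseteq> U"
      using U(1,2) by (meson open_contains_ball subsetD zero_less_one)
    then obtain \<rho> where \<rho>: "\<And>x. \<rho> x > 0" "\<And>x. x \<in> N \<Longrightarrow> ball x (\<rho> x) \<subseteq> U"
      by metis
    \<comment> \<open>The radius \<open>r\<close> serves differentiability at tags outside
      \<open>N\<close>, and \<open>\<rho>\<close> keeps the pieces tagged in \<open>N\<close> inside
      \<open>U\<close>.\<close>
    define \<gamma> where "\<gamma> = (\<lambda>x. ball x (min (r x) (\<rho> x)))"
    show "\<exists>\<gamma>. gauge \<gamma> \<and> (\<forall>\<D>. \<D> tagged_division_of {s..t} \<and> \<gamma> fine \<D> \<longrightarrow>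
        norm ((\<Sum>(x, k)\<in>\<D>. measure lborel k *\<^sub>R g x) - (F t - F s)) < e)"
    proof (intro exI[of _ \<gamma>] conjI allI impI)
      show "gauge \<gamma>"
        unfolding \<gamma>_def by (rule gauge_ball_dependent) (simp add: r(1) \<rho>(1))
    next
      fix p
      assume "p tagged_division_of {s..t} \<and> \<gamma> fine p"
      then have p: "p tagged_division_of {s..t}" and fine: "\<gamma> fine p" by auto
      have fin: "finite p" using p by blast
      have pK: "\<exists>u v. K = {u..v} \<and> u \<le> v \<and> s \<le> u \<and> v \<le> t \<and> u \<le> x \<and> x \<le> v \<and> {u..v} \<subseteq> \<gamma> x"
        if "(x, K) \<in> p" for x K
      proof -
        have "x \<in> K" "K \<subseteq> {s..t}" "\<exists>a b. K = cbox a b"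
          using p that by blast+
        moreover have "K \<subseteq> \<gamma> x" using fine that by blast
        ultimately show ?thesis by auto
      qed
      define lo where "lo = (\<lambda>k::real \<times> real set. Inf (snd k))"
      define hi where "hi = (\<lambda>k::real \<times> real set. Sup (snd k))"
      have pk: "snd k = {lo k..hi k} \<and> lo k \<le> hi k \<and> s \<le> lo k \<and> hi k \<le> t \<and> lo k \<le> fst k
          \<and> fst k \<le> hi k \<and> {lo k..hi k} \<subseteq> \<gamma> (fst k)" if "k \<in> p" for k
        using pK[of "fst k" "snd k"] that unfolding lo_def hi_def by auto
      have tele: "(\<Sum>k\<in>p. F (hi k) - F (lo k)) = F t - F s"
        using additive_tagged_division_1[OF \<open>s \<le> t\<close> p, of F] by (simp add: lo_def hi_def case_prod_unfold)
      have tel: "(\<Sum>k\<in>p. hi k - lo k) = t - s"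
        using additive_tagged_division_1[OF \<open>s \<le> t\<close> p, of "\<lambda>x. x"] by (simp add: lo_def hi_def case_prod_unfold)
      define T where "T = (\<lambda>k. (hi k - lo k) *\<^sub>R g (fst k) - (F (hi k) - F (lo k)))"
      have sumT: "(\<Sum>(x, k)\<in>p. measure lborel k *\<^sub>R g x) - (F t - F s) = (\<Sum>k\<in>p. T k)"
      proof -
        have "(\<Sum>(x, k)\<in>p. measure lborel k *\<^sub>R g x) = (\<Sum>k\<in>p. (hi k - lo k) *\<^sub>R g (fst k))"
          unfolding case_prod_unfold
          by (rule sum.cong) (use pk in \<open>auto simp: content_real\<close>)
        then show ?thesis by (simp add: T_def sum_subtractf tele[symmetric])
      qed
      \<comment> \<open>Degenerate pieces are excluded: a single point may sit in the interior of
        another piece, which would violate the ordering that absolute continuity asks for. Their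
        term \<open>T k\<close> is zero anyway.\<close>
      define A where "A = {k \<in> p. fst k \<in> N \<and> lo k < hi k}"
      have good: "norm (T k) \<le> e' * (hi k - lo k)" if "k \<in> p - A" for k
      proof (cases "fst k \<in> N")
        case True
        then have "lo k = hi k" using that pk[of k] by (auto simp: A_def)
        then show ?thesis by (simp add: T_def)
      next
        case False
        have kp: "k \<in> p" using that by auto
        define x u v where "x = fst k" and "u = lo k" and "v = hi k"
        have k: "u \<le> x" "x \<le> v" "s \<le> u" "v \<le> t" "{u..v} \<subseteq> ball x (r x)"
          using pk[OF kp] by (auto simp: x_def u_def v_def \<gamma>_def)
        have xs: "x \<in> {s..t} - N" using k False by (auto simp: x_def)
        have "u \<in> {u..v}" "v \<in> {u..v}" using k by auto
        then have nu: "norm (u - x) < r x" "norm (v - x) < r x"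
          using k(5) by (auto simp: subset_iff dist_real_def abs_minus_commute)
        \<comment> \<open>The tag splits the piece, and both ends are compared with the same tangent
          at \<open>x\<close>.\<close>
        have "T k = (F u - F x - (u - x) *\<^sub>R g x) - (F v - F x - (v - x) *\<^sub>R g x)"
          by (simp add: T_def x_def u_def v_def algebra_simps)
        then have "norm (T k) \<le> norm (F u - F x - (u - x) *\<^sub>R g x) + norm (F v - F x - (v - x) *\<^sub>R g x)"
          by (metis norm_triangle_ineq4)
        also have "\<dots> \<le> e' * norm (u - x) + e' * norm (v - x)"
          using r(2)[OF xs nu(1)] r(2)[OF xs nu(2)] by linarith
        also have "\<dots> = e' * (v - u)"
          using k by (simp add: algebra_simps)
        finally show ?thesis by (simp add: u_def v_def)
      qed
      have finA: "finite A" and Ap: "A \<subseteq> p" using fin by (auto simp: A_def)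
      have TA: "norm (T k) = norm (F (hi k) - F (lo k))" if "k \<in> A" for k
        using that by (simp add: T_def A_def g_def norm_minus_commute)
      have int: "{lo j<..<hi j} \<inter> {lo k<..<hi k} = {}" if "j \<in> p" "k \<in> p" "j \<noteq> k" for j k
      proof -
        have "(fst j, snd j) \<in> p" "(fst k, snd k) \<in> p" using that by auto
        moreover have "(fst j, snd j) \<noteq> (fst k, snd k)" using that by (simp add: prod_eq_iff)
        ultimately have "interior (snd j) \<inter> interior (snd k) = {}"
          using tagged_division_ofD(5)[OF p] by blast
        then show ?thesis using pk[OF that(1)] pk[OF that(2)] interior_atLeastAtMost_real by metis
      qed
      have disj: "hi j \<le> lo k \<or> hi k \<le> lo j" if "j \<in> A" "k \<in> A" "j \<noteq> k" for j k
      proof (rule ccontr)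
        assume "\<not> ?thesis"
        moreover have "lo j < hi j" "lo k < hi k" using that by (auto simp: A_def)
        ultimately have "max (lo j) (lo k) < min (hi j) (hi k)" by auto
        then obtain y where "max (lo j) (lo k) < y" "y < min (hi j) (hi k)" using dense by blast
        then have "y \<in> {lo j<..<hi j} \<inter> {lo k<..<hi k}" by auto
        then show False using int[of j k] that Ap by blast
      qed
      have "(\<Sum>k\<in>A. hi k - lo k) < d"
      proof -
        have "(\<Sum>k\<in>A. ennreal (hi k - lo k)) = (\<Sum>k\<in>A. emeasure lborel {lo k<..<hi k})"
          by (rule sum.cong) (auto simp: A_def)
        also have "\<dots> = emeasure lborel (\<Union>k\<in>A. {lo k<..<hi k})"
        proof (rule sum_emeasure)
          show "disjoint_family_on (\<lambda>k. {lo k<..<hi k}) A"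
            unfolding disjoint_family_on_def using int Ap by blast
        qed (use finA in auto)
        also have "\<dots> \<le> emeasure lborel U"
        proof (rule emeasure_mono)
          show "(\<Union>k\<in>A. {lo k<..<hi k}) \<subseteq> U"
          proof (rule UN_least)
            fix k assume "k \<in> A"
            then have "k \<in> p" "fst k \<in> N" by (auto simp: A_def)
            then have "{lo k..hi k} \<subseteq> ball (fst k) (\<rho> (fst k))"
              using pk[of k] by (auto simp: \<gamma>_def)
            then show "{lo k<..<hi k} \<subseteq> U" using \<rho>(2)[OF \<open>fst k \<in> N\<close>] by force
          qed
        qed (use U in auto)
        also note mU
        finally have "ennreal (\<Sum>k\<in>A. hi k - lo k) < ennreal d"
          by (subst sum_ennreal[symmetric]) (auto simp: A_def)
        moreover have "0 \<le> (\<Sum>k\<in>A. hi k - lo k)"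
          by (rule sum_nonneg) (simp add: A_def)
        ultimately show ?thesis by (simp add: ennreal_less_iff)
      qed
      then have "(\<Sum>k\<in>A. norm (F (hi k) - F (lo k))) < e / 2"
        by (intro d[rule_format] conjI ballI impI finA disj) (use pk Ap in auto)
      then have bad: "(\<Sum>k\<in>A. norm (T k)) < e / 2" by (simp add: TA)
      have "(\<Sum>k\<in>p. norm (T k)) = (\<Sum>k\<in>p - A. norm (T k)) + (\<Sum>k\<in>A. norm (T k))"
        by (rule sum.subset_diff[OF Ap fin])
      moreover have "(\<Sum>k\<in>p - A. norm (T k)) \<le> (\<Sum>k\<in>p - A. e' * (hi k - lo k))"
        by (rule sum_mono[OF good])
      moreover have "\<dots> \<le> (\<Sum>k\<in>p. e' * (hi k - lo k))"
        by (rule sum_mono2) (use fin pk \<open>e' > 0\<close> in auto)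
      moreover have "\<dots> = e' * (t - s)"
        by (simp add: sum_distrib_left[symmetric] tel)
      ultimately have "(\<Sum>k\<in>p. norm (T k)) < e" using bad e't by linarith
      then show "norm ((\<Sum>(x, k)\<in>p. measure lborel k *\<^sub>R g x) - (F t - F s)) < e"
        unfolding sumT using norm_sum[of T p] by linarith
    qed
  qed
qed

section \<open>Closure properties of absolute continuity\<close>

lemma abs_cont_on_dominated:
  assumes F: "abs_cont_on s t F" and G: "abs_cont_on s t G"
    and H: "\<And>x y. \<lbrakk>s \<le> x; x \<le> y; y \<le> t\<rbrakk> \<Longrightarrow> norm (H y - H x) \<le> C * (norm (F y - F x) + norm (G y - G x))"
  shows "abs_cont_on s t H"
  unfolding abs_cont_on_def
proof (intro allI impI)
  fix e :: real
  assume "e > 0"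
  \<comment> \<open>\<open>C\<close> may be zero or negative, hence
    \<open>\<bar>C\<bar> + 1\<close>; the factor 2 shares \<open>e\<close> between \<open>F\<close>
    and \<open>G\<close>.\<close>
  define e' where "e' = e / (2 * (\<bar>C\<bar> + 1))"
  have "e' > 0" using \<open>e > 0\<close> by (simp add: e'_def)
  from F[unfolded abs_cont_on_def, THEN spec, THEN mp, OF \<open>e' > 0\<close>] obtain d1 where "d1 > 0" and d1: "\<forall>(n::nat) (a::nat\<Rightarrow>real) b.
        (\<forall>k<n. s \<le> a k \<and> a k \<le> b k \<and> b k \<le> t) \<and>
        (\<forall>j<n. \<forall>k<n. j \<noteq> k \<longrightarrow> b j \<le> a k \<or> b k \<le> a j) \<and>
        (\<Sum>k<n. b k - a k) < d1 \<longrightarrow> (\<Sum>k<n. norm (F (b k) - F (a k))) < e'"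
    by (elim exE conjE) (rule that; assumption)
  from G[unfolded abs_cont_on_def, THEN spec, THEN mp, OF \<open>e' > 0\<close>] obtain d2 where "d2 > 0" and d2: "\<forall>(n::nat) (a::nat\<Rightarrow>real) b.
        (\<forall>k<n. s \<le> a k \<and> a k \<le> b k \<and> b k \<le> t) \<and>
        (\<forall>j<n. \<forall>k<n. j \<noteq> k \<longrightarrow> b j \<le> a k \<or> b k \<le> a j) \<and>
        (\<Sum>k<n. b k - a k) < d2 \<longrightarrow> (\<Sum>k<n. norm (G (b k) - G (a k))) < e'"
    by (elim exE conjE) (rule that; assumption)
  show "\<exists>d>0. \<forall>(n::nat) (a::nat\<Rightarrow>real) b.
        (\<forall>k<n. s \<le> a k \<and> a k \<le> b k \<and> b k \<le> t) \<and>
        (\<forall>j<n. \<forall>k<n. j \<noteq> k \<longrightarrow> b j \<le> a k \<or> b k \<le> a j) \<and>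
        (\<Sum>k<n. b k - a k) < d
        \<longrightarrow> (\<Sum>k<n. norm (H (b k) - H (a k))) < e"
  proof (intro exI[of _ "min d1 d2"] conjI allI impI; (elim conjE)?)
    show "min d1 d2 > 0" using \<open>d1 > 0\<close> \<open>d2 > 0\<close> by simp
  next
    fix n :: nat and a b :: "nat \<Rightarrow> real"
    assume ab: "\<forall>k<n. s \<le> a k \<and> a k \<le> b k \<and> b k \<le> t"
      and dis: "\<forall>j<n. \<forall>k<n. j \<noteq> k \<longrightarrow> b j \<le> a k \<or> b k \<le> a j"
      and len: "(\<Sum>k<n. b k - a k) < min d1 d2"
    have 1: "(\<Sum>k<n. norm (F (b k) - F (a k))) < e'"
      by (intro d1[rule_format] conjI ab dis) (use len in simp)
    have 2: "(\<Sum>k<n. norm (G (b k) - G (a k))) < e'"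
      by (intro d2[rule_format] conjI ab dis) (use len in simp)
    have "(\<Sum>k<n. norm (H (b k) - H (a k)))
        \<le> (\<Sum>k<n. (\<bar>C\<bar> + 1) * (norm (F (b k) - F (a k)) + norm (G (b k) - G (a k))))"
    proof (rule sum_mono)
      fix k assume "k \<in> {..<n}"
      then have "norm (H (b k) - H (a k)) \<le> C * (norm (F (b k) - F (a k)) + norm (G (b k) - G (a k)))"
        using ab by (intro H) auto
      also have "\<dots> \<le> (\<bar>C\<bar> + 1) * (norm (F (b k) - F (a k)) + norm (G (b k) - G (a k)))"
        by (rule mult_right_mono) auto
      finally show "norm (H (b k) - H (a k))
        \<le> (\<bar>C\<bar> + 1) * (norm (F (b k) - F (a k)) + norm (G (b k) - G (a k)))" .
    qed
    also have "\<dots> = (\<bar>C\<bar> + 1) * ((\<Sum>k<n. norm (F (b k) - F (a k))) + (\<Sum>k<n. norm (G (b k) - G (a k))))"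
      by (simp only: sum_distrib_left[symmetric] sum.distrib)
    also have "\<dots> < (\<bar>C\<bar> + 1) * (e' + e')"
      using 1 2 by (intro mult_strict_left_mono) auto
    also have "\<dots> = e" by (simp add: e'_def divide_simps)
    finally show "(\<Sum>k<n. norm (H (b k) - H (a k))) < e" .
  qed
qed

lemma AC_loc_continuous:
  assumes "AC_loc F"
  shows "continuous_on UNIV F"
  unfolding continuous_on_iff
proof (intro ballI allI impI)
  fix x e :: real
  assume "e > 0"
  have "abs_cont_on (x - 1) (x + 1) F" using assms by (simp add: AC_loc_def)
  from abs_cont_on_family[OF this \<open>e > 0\<close>]
  obtain d where "d > 0" and d: "\<forall>(I::unit set) a b. finite I \<and> (\<forall>k\<in>I. x - 1 \<le> a k \<and> a k \<le> b k \<and> b k \<le> x + 1) \<and>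
       (\<forall>j\<in>I. \<forall>k\<in>I. j \<noteq> k \<longrightarrow> b j \<le> a k \<or> b k \<le> a j) \<and> (\<Sum>k\<in>I. b k - a k) < d
       \<longrightarrow> (\<Sum>k\<in>I. norm (F (b k) - F (a k))) < e"
    by (elim exE conjE) (rule that; assumption)
  have *: "norm (F v - F u) < e" if "x - 1 \<le> u" "u \<le> v" "v \<le> x + 1" "v - u < d" for u v
    using d[rule_format, of "{()}" "\<lambda>_. u" "\<lambda>_. v"] that by simp
  show "\<exists>d>0. \<forall>x'\<in>UNIV. dist x' x < d \<longrightarrow> dist (F x') (F x) < e"
  proof (intro exI[of _ "min d 1"] conjI ballI impI)
    fix y assume y: "dist y x < min d 1"
    show "dist (F y) (F x) < e"
      using *[of x y] *[of y x] y
      by (cases "x \<le> y") (auto simp: dist_norm abs_if norm_minus_commute split: if_splits)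
  qed (use \<open>d > 0\<close> in simp)
qed

lemma AC_loc_bounded_linear:
  assumes "AC_loc F" "bounded_linear h"
  shows "AC_loc (\<lambda>x. h (F x))"
proof -
  interpret bounded_linear h by fact
  obtain K where K: "\<And>x. norm (h x) \<le> norm x * K" using bounded by blast
  \<comment> \<open>\<open>F\<close> is counted twice only to match the two-function form of
    \<open>abs_cont_on_dominated\<close>.\<close>
  have "norm (h (F y) - h (F x)) \<le> \<bar>K\<bar> * (norm (F y - F x) + norm (F y - F x))" for x y
  proof -
    have "norm (h (F y) - h (F x)) \<le> norm (F y - F x) * K" using K[of "F y - F x"] by (simp add: diff)
    also have "\<dots> \<le> norm (F y - F x) * \<bar>K\<bar>" by (rule mult_left_mono) auto
    also have "\<dots> \<le> \<bar>K\<bar> * (norm (F y - F x) + norm (F y - F x))"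
      by (simp add: algebra_simps)
    finally show ?thesis .
  qed
  then show ?thesis
    unfolding AC_loc_def
    by (intro allI, rule abs_cont_on_dominated[OF assms(1)[unfolded AC_loc_def, rule_format] assms(1)[unfolded AC_loc_def, rule_format]])
qed

lemma AC_loc_add:
  assumes "AC_loc F" "AC_loc G"
  shows "AC_loc (\<lambda>x. F x + G x)"
proof -
  have "norm (F y + G y - (F x + G x)) \<le> 1 * (norm (F y - F x) + norm (G y - G x))" for x y
    using norm_triangle_ineq[of "F y - F x" "G y - G x"] by (simp add: algebra_simps)
  then show ?thesis
    unfolding AC_loc_def
    by (intro allI, rule abs_cont_on_dominated[OF assms(1)[unfolded AC_loc_def, rule_format] assms(2)[unfolded AC_loc_def, rule_format]])
qed

lemma AC_loc_uminus: "AC_loc F \<Longrightarrow> AC_loc (\<lambda>x. - F x)"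
  by (erule AC_loc_bounded_linear) (rule bounded_linear_minus[OF bounded_linear_ident])

lemma AC_loc_diff: "AC_loc F \<Longrightarrow> AC_loc G \<Longrightarrow> AC_loc (\<lambda>x. F x - G x)"
  using AC_loc_add[OF _ AC_loc_uminus] by fastforce

lemma AC_loc_mult:
  fixes F G :: "real \<Rightarrow> 'a::real_normed_algebra"
  assumes F: "AC_loc F" and G: "AC_loc G"
  shows "AC_loc (\<lambda>x. F x * G x)"
  unfolding AC_loc_def
proof (intro allI)
  fix s t
  have "bounded (F ` {s..t})" "bounded (G ` {s..t})"
    using AC_loc_continuous[OF F] AC_loc_continuous[OF G]
    by (auto intro!: compact_imp_bounded compact_continuous_image intro: continuous_on_subset)
  then obtain A B where A: "\<And>x. x \<in> {s..t} \<Longrightarrow> norm (F x) \<le> A" and B: "\<And>x. x \<in> {s..t} \<Longrightarrow> norm (G x) \<le> B"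
    unfolding bounded_iff by blast
  define C where "C = \<bar>A\<bar> + \<bar>B\<bar>"
  have "norm (F y * G y - F x * G x) \<le> C * (norm (F y - F x) + norm (G y - G x))"
    if "s \<le> x" "x \<le> y" "y \<le> t" for x y
  proof -
    have "F y * G y - F x * G x = (F y - F x) * G x + F y * (G y - G x)"
      by (simp add: algebra_simps)
    then have "norm (F y * G y - F x * G x) \<le> norm (F y - F x) * norm (G x) + norm (F y) * norm (G y - G x)"
      by (metis norm_triangle_le norm_mult_ineq add_mono)
    also have "\<dots> \<le> norm (F y - F x) * C + C * norm (G y - G x)"
      using A[of y] B[of x] that by (intro add_mono mult_left_mono mult_right_mono) (auto simp: C_def)
    finally show ?thesis by (simp add: algebra_simps)
  qed
  then show "abs_cont_on s t (\<lambda>x. F x * G x)"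
    by (rule abs_cont_on_dominated[OF F[unfolded AC_loc_def, rule_format] G[unfolded AC_loc_def, rule_format]])
qed

theorem AC_loc_has_integral:
  fixes F :: "real \<Rightarrow> 'a::banach"
  assumes "AC_loc F" "s \<le> t" and "AE x in lborel. x \<in> {s<..<t} \<longrightarrow> (F has_vector_derivative f x) (at x)"
  shows "(f has_integral (F t - F s)) {s..t}"
proof -
  obtain N where "{x \<in> space lborel. \<not> (x \<in> {s<..<t} \<longrightarrow> (F has_vector_derivative f x) (at x))} \<subseteq> N"
    "emeasure lborel N = 0" "N \<in> sets lborel"
    using AE_E[OF assms(3)] by blast
  then have N: "N \<in> null_sets lborel" "{x. \<not> (x \<in> {s<..<t} \<longrightarrow> (F has_vector_derivative f x) (at x))} \<subseteq> N"
    by auto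
  have "N \<in> null_sets lebesgue" using N(1) by (rule null_sets_completionI)
  \<comment> \<open>The endpoints join the exceptional set, since the derivative is prescribed on
    the open interval only.\<close>
  then have "negligible (N \<union> {s,t})" by (simp add: negligible_iff_null_sets)
  then show ?thesis
    using assms(1,2) N(2) by (intro abs_cont_on_has_integral[where N="N \<union> {s,t}"]) (force simp: AC_loc_def)+
qed

section \<open>Indefinite integrals: absolute continuity and differentiation almost
  everywhere\<close>

lemma sum_nonoverlapping_integral_le:
  fixes D :: "real \<Rightarrow> real"
  assumes D: "D integrable_on {s..t}" "\<And>x. D x \<ge> 0"
    and ab: "\<forall>k<n::nat. s \<le> a k \<and> a k \<le> b k \<and> b k \<le> t"
    and dis: "\<forall>j<n. \<forall>k<n. j \<noteq> k \<longrightarrow> b j \<le> a k \<or> b k \<le> a j"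
  shows "(\<Sum>k<n. integral {a k..b k} D) \<le> integral {s..t} D"
proof -
  \<comment> \<open>On open intervals, pieces that share an endpoint are disjoint, so at each point
    at most one summand survives and the sum stays below \<open>D\<close>.\<close>
  define E where "E = (\<lambda>k x. if x \<in> {a k<..<b k} then D x else 0)"
  have Ek: "(E k has_integral integral {a k..b k} D) {s..t}" if "k < n" for k
  proof -
    have sub: "{a k..b k} \<subseteq> {s..t}" "{a k<..<b k} \<subseteq> {s..t}" using ab that by auto
    have "(D has_integral integral {a k..b k} D) {a k..b k}"
      using integrable_on_subinterval[OF D(1) sub(1)] by (rule integrable_integral)
    then have "(D has_integral integral {a k..b k} D) {a k<..<b k}"
      using has_integral_open_interval[of D _ "a k" "b k"] by simp
    then show ?thesis
      unfolding E_def using has_integral_restrict[OF sub(2)] by blast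
  qed
  have "((\<lambda>x. \<Sum>k<n. E k x) has_integral (\<Sum>k<n. integral {a k..b k} D)) {s..t}"
    by (rule has_integral_sum) (use Ek in auto)
  moreover have "(\<Sum>k<n. E k x) \<le> D x" for x
  proof (cases "\<exists>k<n. x \<in> {a k<..<b k}")
    case True
    then obtain k0 where k0: "k0 < n" "x \<in> {a k0<..<b k0}" by blast
    have "E k x = (if k = k0 then D x else 0)" if "k < n" for k
    proof (cases "k = k0")
      case False
      then have "x \<notin> {a k<..<b k}" using dis[rule_format, of k k0] k0 that by auto
      then show ?thesis using False by (auto simp: E_def)
    qed (use k0 in \<open>auto simp: E_def\<close>)
    then have "(\<Sum>k<n. E k x) = (\<Sum>k<n. if k = k0 then D x else 0)" by (intro sum.cong) auto
    then show ?thesis using k0 by simp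
  next
    case False
    then have "(\<Sum>k<n. E k x) = 0" by (intro sum.neutral) (auto simp: E_def)
    then show ?thesis using D(2) by simp
  qed
  ultimately show ?thesis
    using integrable_integral[OF D(1)] has_integral_le by blast
qed

text \<open>Truncation of \<open>norm (f x)\<close> at a height \<open>m\<close>: the truncated part
  contributes at most \<open>m\<close> times the total length, and the excess \<open>D\<close> has
  integral below \<open>e / 2\<close> over all of \<open>{s..t}\<close> once \<open>m\<close> is
  large.\<close>

theorem AC_loc_indefinite_integral:
  fixes f :: "real \<Rightarrow> 'b::euclidean_space"
  assumes f: "\<And>a b. f absolutely_integrable_on {a..b}"
    and F: "\<And>x y. x \<le> y \<Longrightarrow> F y - F x = integral {x..y} f"
  shows "AC_loc F"
  unfolding AC_loc_def
proof (intro allI)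
  fix s t :: real
  define g where "g = (\<lambda>x. norm (f x))"
  have g: "g integrable_on {a..b}" for a b
    using f[of a b] unfolding g_def absolutely_integrable_on_def by simp
  define h where "h = (\<lambda>n x. min (g x) (real n))"
  have h: "h n integrable_on {a..b}" for n a b
  proof -
    have "g absolutely_integrable_on {a..b}"
      using g by (intro nonnegative_absolutely_integrable_1) (auto simp: g_def)
    then have "h n absolutely_integrable_on {a..b}"
      unfolding h_def by (rule absolutely_integrable_min_1) (auto intro: absolutely_integrable_on_const)
    then show ?thesis by (rule set_lebesgue_integral_eq_integral(1))
  qed
  have "(\<lambda>n. integral {s..t} (h n)) \<longlonglongrightarrow> integral {s..t} g"
  proof (rule dominated_convergence(2))
    show "norm (h n x) \<le> g x" for n x by (auto simp: h_def g_def)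
    show "(\<lambda>n. h n x) \<longlonglongrightarrow> g x" for x
    proof (rule tendsto_eventually)
      obtain m where "g x \<le> real m" using real_arch_simple by blast
      then show "\<forall>\<^sub>F n in sequentially. h n x = g x"
        by (intro eventually_sequentiallyI[of m]) (auto simp: h_def)
    qed
  qed (use g h in auto)
  show "abs_cont_on s t F"
    unfolding abs_cont_on_def
  proof (intro allI impI)
    fix e :: real
    assume "e > 0"
    obtain m where m: "\<bar>integral {s..t} (h m) - integral {s..t} g\<bar> < e / 2"
      using LIMSEQ_D[OF \<open>(\<lambda>n. integral {s..t} (h n)) \<longlonglongrightarrow> integral {s..t} g\<close>, of "e/2"] \<open>e > 0\<close> by auto
    define D where "D = (\<lambda>x. g x - h m x)"
    have D0: "D x \<ge> 0" for x by (simp add: D_def h_def)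
    have D: "D integrable_on {a..b}" for a b unfolding D_def by (intro integrable_diff g h)
    have intD: "integral {s..t} D < e / 2"
      using m unfolding D_def by (subst integral_diff[OF g h]) (simp add: abs_if split: if_splits)
    \<comment> \<open>Chosen so that \<open>real m * d\<close> is below \<open>e / 2\<close>; the
      summand 1 covers \<open>m = 0\<close>.\<close>
    define d where "d = e / (2 * (real m + 1))"
    have "d > 0" using \<open>e > 0\<close> by (simp add: d_def)
    have md: "real m * d < e / 2" using \<open>e > 0\<close> by (simp add: d_def field_simps)
    show "\<exists>d>0. \<forall>(n::nat) (a::nat\<Rightarrow>real) b.
        (\<forall>k<n. s \<le> a k \<and> a k \<le> b k \<and> b k \<le> t) \<and>
        (\<forall>j<n. \<forall>k<n. j \<noteq> k \<longrightarrow> b j \<le> a k \<or> b k \<le> a j) \<and>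
        (\<Sum>k<n. b k - a k) < d
        \<longrightarrow> (\<Sum>k<n. norm (F (b k) - F (a k))) < e"
    proof (intro exI[of _ d] conjI allI impI \<open>d > 0\<close>; elim conjE)
      fix n :: nat and a b :: "nat \<Rightarrow> real"
      assume ab: "\<forall>k<n. s \<le> a k \<and> a k \<le> b k \<and> b k \<le> t"
        and dis: "\<forall>j<n. \<forall>k<n. j \<noteq> k \<longrightarrow> b j \<le> a k \<or> b k \<le> a j"
        and len: "(\<Sum>k<n. b k - a k) < d"
      have "norm (F (b k) - F (a k)) \<le> integral {a k..b k} D + real m * (b k - a k)" if "k < n" for k
      proof -
        have k: "a k \<le> b k" using ab that by auto
        have "norm (F (b k) - F (a k)) \<le> integral {a k..b k} g"
          unfolding F[OF k] using f[of "a k" "b k"] g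
          by (intro integral_norm_bound_integral) (auto simp: g_def intro: set_lebesgue_integral_eq_integral(1))
        also have "g = (\<lambda>x. D x + h m x)" by (simp add: D_def)
        also have "integral {a k..b k} (\<lambda>x. D x + h m x) = integral {a k..b k} D + integral {a k..b k} (h m)"
          by (rule integral_add[OF D h])
        also have "integral {a k..b k} (h m) \<le> integral {a k..b k} (\<lambda>_. real m)"
          by (rule integral_le[OF h]) (auto simp: h_def)
        finally show ?thesis using k by (simp add: algebra_simps)
      qed
      then have "(\<Sum>k<n. norm (F (b k) - F (a k))) \<le> (\<Sum>k<n. integral {a k..b k} D + real m * (b k - a k))"
        by (intro sum_mono) auto
      also have "\<dots> = (\<Sum>k<n. integral {a k..b k} D) + real m * (\<Sum>k<n. b k - a k)"
        by (simp add: sum.distrib sum_distrib_left)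
      also have "\<dots> \<le> integral {s..t} D + real m * d"
        using sum_nonoverlapping_integral_le[OF D D0 ab dis] len by (intro add_mono mult_left_mono) auto
      also have "\<dots> < e" using intD md by simp
      finally show "(\<Sum>k<n. norm (F (b k) - F (a k))) < e" .
    qed
  qed
qed

text \<open>Right difference quotients converge outside a negligible set. The left ones are the
  right ones of the reflected function, so a second exceptional set, reflected back, completes the
  two-sided derivative.\<close>

theorem AE_has_vector_derivative_indefinite_integral:
  fixes f :: "real \<Rightarrow> 'b::euclidean_space"
  assumes f: "\<And>a b. f integrable_on {a..b}"
    and F: "\<And>x y. x \<le> y \<Longrightarrow> F y - F x = integral {x..y} f"
  shows "AE x in lborel. (F has_vector_derivative f x) (at x)"
proof -
  obtain N where N: "negligible N"
       "\<And>x e. \<lbrakk>x \<notin> N; 0 < e\<rbrakk> \<Longrightarrow> \<exists>d>0. \<forall>h. 0 < h \<and> h < d \<longrightarrow>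
                         norm (integral {x..x + h} f /\<^sub>R h - f x) < e"
    using integrable_ccontinuous_explicit[of f] f by auto
  have fr: "(\<lambda>x. f (-x)) integrable_on {a..b}" for a b
    using f[of "-b" "-a"] Henstock_Kurzweil_Integration.integrable_reflect_real[of f "-a" "-b"] by simp
  obtain M where M: "negligible M"
       "\<And>x e. \<lbrakk>x \<notin> M; 0 < e\<rbrakk> \<Longrightarrow> \<exists>d>0. \<forall>h. 0 < h \<and> h < d \<longrightarrow>
                         norm (integral {x..x + h} (\<lambda>x. f (-x)) /\<^sub>R h - f (-x)) < e"
    using integrable_ccontinuous_explicit[of "\<lambda>x. f (-x)"] fr by auto
  have "negligible (uminus ` M)"
    by (rule negligible_differentiable_image_negligible[OF order_refl M(1)]) (intro differentiable_on_minus differentiable_on_ident)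
  with N(1) have "N \<union> uminus ` M \<in> null_sets lebesgue"
    unfolding negligible_iff_null_sets[symmetric] by (rule negligible_Un)
  \<comment> \<open>The exceptional set is only Lebesgue null; an almost everywhere statement for
    \<open>lborel\<close> needs a Borel null set around it.\<close>
  then obtain N' where N': "N' \<in> null_sets lborel" "N \<union> uminus ` M \<subseteq> N'"
    unfolding null_sets_completion_iff2 by (elim bexE) (rule that; assumption)
  show ?thesis
  proof (rule AE_I')
    show "N' \<in> null_sets lborel" by fact
    show "{x \<in> space lborel. \<not> (F has_vector_derivative f x) (at x)} \<subseteq> N'"
    proof (intro subsetI, rule ccontr)
      fix x
      assume x: "x \<in> {x \<in> space lborel. \<not> (F has_vector_derivative f x) (at x)}" and "x \<notin> N'"
      then have xN: "x \<notin> N" and xM: "- x \<notin> M" using N'(2) by force+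
      have "(F has_vector_derivative f x) (at x)"
        unfolding has_vector_derivative_def has_derivative_within_alt
      proof (intro conjI allI impI bounded_linear_scaleR_left)
        fix e :: real
        assume "e > 0"
        obtain d1 where d1: "d1 > 0" "\<And>h. 0 < h \<Longrightarrow> h < d1 \<Longrightarrow> norm (integral {x..x + h} f /\<^sub>R h - f x) < e"
          using N(2)[OF xN \<open>e > 0\<close>] by blast
        obtain d2 where d2: "d2 > 0" "\<And>h. 0 < h \<Longrightarrow> h < d2 \<Longrightarrow> norm (integral {-x..-x + h} (\<lambda>x. f (-x)) /\<^sub>R h - f x) < e"
          using M(2)[OF xM \<open>e > 0\<close>] by auto
        have scale: "norm (v - h *\<^sub>R w) \<le> e * h" if "norm (v /\<^sub>R h - w) < e" "h > 0" for v w :: 'b and h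
        proof -
          have "v - h *\<^sub>R w = h *\<^sub>R (v /\<^sub>R h - w)" using that by (simp add: algebra_simps)
          then have "norm (v - h *\<^sub>R w) = h * norm (v /\<^sub>R h - w)" using that by simp
          then show ?thesis using that by (simp add: mult.commute)
        qed
        show "\<exists>d>0. \<forall>y\<in>UNIV. norm (y - x) < d \<longrightarrow> norm (F y - F x - (y - x) *\<^sub>R f x) \<le> e * norm (y - x)"
        proof (intro exI[of _ "min d1 d2"] conjI ballI impI)
          fix y assume y: "norm (y - x) < min d1 d2"
          consider "y = x" | "y > x" | "y < x" by linarith
          then show "norm (F y - F x - (y - x) *\<^sub>R f x) \<le> e * norm (y - x)"
          proof cases
            case 2
            then show ?thesis
              using scale[OF d1(2)[of "y - x"]] y F[of x y] by simp
          next
            case 3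
            have "integral {-x..-x + (x - y)} (\<lambda>x. f (-x)) = F x - F y"
              using F[of y x] 3 Henstock_Kurzweil_Integration.integral_reflect_real[of y x f] by simp
            then have "norm (F x - F y - (x - y) *\<^sub>R f x) \<le> e * (x - y)"
              using scale[OF d2(2)[of "x - y"]] y 3 by simp
            moreover have "F x - F y - (x - y) *\<^sub>R f x = - (F y - F x - (y - x) *\<^sub>R f x)"
              by (simp add: algebra_simps)
            ultimately have "norm (F y - F x - (y - x) *\<^sub>R f x) \<le> e * (x - y)" by (metis norm_minus_cancel)
            then show ?thesis using 3 by simp
          qed simp
        qed (use d1(1) d2(1) in simp)
      qed
      then show False using x by simp
    qed
  qed
qed

section \<open>Linear systems with locally integrable coefficients\<close>

text \<open>The signed integral from 0 to \<open>x\<close>: one of the two intervals is always empty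
  or a point. It lets a solution be continued from 0 in both directions at once.\<close>

definition oriented_integral :: "(real \<Rightarrow> 'b::euclidean_space) \<Rightarrow> real \<Rightarrow> 'b" where
  "oriented_integral f x = integral {0..x} f - integral {x..0} f"

lemma oriented_integral_nonneg: "0 \<le> x \<Longrightarrow> oriented_integral f x = integral {0..x} f"
  by (cases "x = 0") (auto simp: oriented_integral_def)

lemma oriented_integral_nonpos: "x \<le> 0 \<Longrightarrow> oriented_integral f x = - integral {x..0} f"
  by (cases "x = 0") (auto simp: oriented_integral_def)

lemma oriented_integral_scaleR: "oriented_integral (\<lambda>s. c *\<^sub>R f s) x = c *\<^sub>R oriented_integral f x"
  by (simp add: oriented_integral_def scaleR_diff_right)

lemma oriented_integral_diff:
  assumes f: "\<And>a b. f integrable_on {a..b}" and "x \<le> y"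
  shows "oriented_integral f y - oriented_integral f x = integral {x..y} f"
proof -
  consider "0 \<le> x" | "x \<le> 0" "0 \<le> y" | "y \<le> 0" by linarith
  then show ?thesis
  proof cases
    case 1
    then show ?thesis
      using Henstock_Kurzweil_Integration.integral_combine[OF 1 \<open>x \<le> y\<close> f] \<open>x \<le> y\<close>
      by (simp add: oriented_integral_nonneg algebra_simps)
  next
    case 2
    then show ?thesis
      using Henstock_Kurzweil_Integration.integral_combine[OF 2 f]
      by (simp add: oriented_integral_nonneg oriented_integral_nonpos algebra_simps)
  next
    case 3
    then show ?thesis
      using Henstock_Kurzweil_Integration.integral_combine[OF \<open>x \<le> y\<close> 3 f] \<open>x \<le> y\<close>
      by (simp add: oriented_integral_nonpos algebra_simps)
  qed
qed

lemma oriented_integral_norm_bound: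
  assumes f: "\<And>a b. f integrable_on {a..b}" and g: "\<And>a b. g integrable_on {a..b}"
    and fg: "\<And>s. min 0 x \<le> s \<Longrightarrow> s \<le> max 0 x \<Longrightarrow> norm (f s) \<le> (g s :: real)"
  shows "norm (oriented_integral f x) \<le> \<bar>oriented_integral g x\<bar>"
proof (cases "0 \<le> x")
  case True
  then have "norm (integral {0..x} f) \<le> integral {0..x} g"
    by (intro integral_norm_bound_integral f g fg) auto
  then show ?thesis using True by (simp add: oriented_integral_nonneg)
next
  case False
  then have "norm (integral {x..0} f) \<le> integral {x..0} g"
    by (intro integral_norm_bound_integral f g fg) auto
  then show ?thesis using False by (simp add: oriented_integral_nonpos)
qed

lemma AC_loc_power:
  fixes F :: "real \<Rightarrow> 'a::real_normed_algebra_1"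
  assumes "AC_loc F"
  shows "AC_loc (\<lambda>x. F x ^ n)"
proof (induction n)
  case 0
  show ?case by (auto simp: AC_loc_def abs_cont_on_def intro: zero_less_one)
next
  case (Suc n)
  then show ?case using AC_loc_mult[OF assms] by simp
qed

text \<open>This produces the factorials in the bound on the Picard increments.\<close>
lemma oriented_integral_power:
  fixes a :: "real \<Rightarrow> real"
  assumes a: "\<And>b c. a absolutely_integrable_on {b..c}"
  defines "K \<equiv> oriented_integral a"
  shows "(\<lambda>s. a s * (K s ^ n / fact n)) integrable_on {b..c}"
    and "oriented_integral (\<lambda>s. a s * (K s ^ n / fact n)) x = K x ^ Suc n / fact (Suc n)"
proof -
  have ai: "a integrable_on {b..c}" for b c using a by (rule set_lebesgue_integral_eq_integral(1))
  have Kd: "K y - K x = integral {x..y} a" if "x \<le> y" for x y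
    unfolding K_def by (rule oriented_integral_diff[OF ai that])
  have AC: "AC_loc K" by (rule AC_loc_indefinite_integral[OF a Kd])
  have AE: "AE x in lborel. (K has_vector_derivative a x) (at x)"
    by (rule AE_has_vector_derivative_indefinite_integral[OF ai Kd])
  define L where "L = (\<lambda>x. K x ^ Suc n * (1 / fact (Suc n)))"
  have ACL: "AC_loc L"
    unfolding L_def by (rule AC_loc_bounded_linear[OF AC_loc_power[OF AC]]) (rule bounded_linear_mult_left)
  have AEL: "AE x in lborel. x \<in> {b<..<c} \<longrightarrow> (L has_vector_derivative a x * (K x ^ n / fact n)) (at x)" for b c
    using AE
  proof eventually_elim
    case (elim x)
    have "(K has_real_derivative a x) (at x)"
      using elim by (simp add: has_real_derivative_iff_has_vector_derivative)
    then have "(L has_real_derivative (of_nat (Suc n) * (a x * K x ^ (Suc n - Suc 0))) * (1 / fact (Suc n))) (at x)"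
      unfolding L_def by (intro DERIV_cmult_right DERIV_power)
    moreover have "(of_nat (Suc n) * (a x * K x ^ (Suc n - Suc 0))) * (1 / fact (Suc n)) = a x * (K x ^ n / fact n)"
      by (simp add: divide_simps del: of_nat_Suc)
    ultimately show ?case by (simp add: has_real_derivative_iff_has_vector_derivative)
  qed
  have hi: "((\<lambda>s. a s * (K s ^ n / fact n)) has_integral (L c - L b)) {b..c}" if "b \<le> c" for b c
    by (rule AC_loc_has_integral[OF ACL that AEL])
  show "(\<lambda>s. a s * (K s ^ n / fact n)) integrable_on {b..c}"
    using hi[of b c] by (cases "b \<le> c") (auto simp: integrable_on_def)
  have L0: "L 0 = 0" by (simp add: L_def K_def oriented_integral_def)
  show "oriented_integral (\<lambda>s. a s * (K s ^ n / fact n)) x = K x ^ Suc n / fact (Suc n)"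
  proof (cases "0 \<le> x")
    case True
    then show ?thesis
      using integral_unique[OF hi[OF True]] L0 by (simp add: oriented_integral_nonneg L_def)
  next
    case False
    then show ?thesis
      using integral_unique[OF hi[of x 0]] L0 by (simp add: oriented_integral_nonpos L_def)
  qed
qed

text \<open>Picard iteration with a Lipschitz constant \<open>a s\<close> that is integrable instead
  of bounded. With \<open>K\<close> the signed primitive of \<open>a\<close>, successive iterates
  differ by at most \<open>norm v\<close> times a power of \<open>\<bar>K x\<bar>\<close> over a
  factorial. The series therefore converges uniformly on compact sets, and one iteration reaches the
  whole line without gluing short intervals. The assumption \<open>meas\<close> hides the
  measurability of the composed coefficient.\<close>

theorem linear_ode_exists:
  fixes A :: "real \<Rightarrow> 'v::euclidean_space \<Rightarrow> 'v" and v :: 'v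
  assumes A_diff: "\<And>s u w. A s (u - w) = A s u - A s w"
    and bd: "\<And>s w. norm (A s w) \<le> a s * norm w"
    and a: "\<And>b c. a absolutely_integrable_on {b..c}" and a0: "\<And>s. a s \<ge> 0"
    and meas: "\<And>E b c. continuous_on UNIV E \<Longrightarrow> (\<lambda>s. A s (E s)) absolutely_integrable_on {b..c}"
  obtains E where "AC_loc E" "E 0 = v" "AE x in lborel. (E has_vector_derivative A x (E x)) (at x)"
proof -
  define K where "K = oriented_integral a"
  have ai: "a integrable_on {b..c}" for b c using a by (rule set_lebesgue_integral_eq_integral(1))
  have ci: "(\<lambda>s. r *\<^sub>R a s) integrable_on {b..c}" for r b c
    by (rule integrable_cmul[OF ai])
  have Kd: "K y - K x = integral {x..y} a" if "x \<le> y" for x y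
    unfolding K_def by (rule oriented_integral_diff[OF ai that])
  have contK: "continuous_on UNIV K"
    by (rule AC_loc_continuous[OF AC_loc_indefinite_integral[OF a Kd]])
  have K_sign: "\<bar>K s\<bar> = (if 0 \<le> x then K s else - K s)" if "min 0 x \<le> s" "s \<le> max 0 x" for s x
    using that Henstock_Kurzweil_Integration.integral_nonneg[OF ai] a0
    by (auto simp: K_def oriented_integral_nonneg oriented_integral_nonpos not_le)
  have Ai: "(\<lambda>s. A s (E s)) integrable_on {b..c}" if "continuous_on UNIV E" for E b c
    using meas[OF that] by (rule set_lebesgue_integral_eq_integral(1))
  define T where "T = (\<lambda>E x. v + oriented_integral (\<lambda>s. A s (E s)) x)"
  have Td: "T E y - T E x = integral {x..y} (\<lambda>s. A s (E s))" if "x \<le> y" "continuous_on UNIV E" for E x y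
    using oriented_integral_diff[OF Ai[OF that(2)] that(1)] by (simp add: T_def)
  have AC_T: "AC_loc (T E)" if "continuous_on UNIV E" for E
    by (rule AC_loc_indefinite_integral[OF meas[OF that] Td[OF _ that]])
  define P where "P = (\<lambda>n. (T ^^ n) (\<lambda>_. v))"
  have P0: "P 0 = (\<lambda>_. v)" and PS: "P (Suc n) = T (P n)" for n by (simp_all add: P_def)
  have contP: "continuous_on UNIV (P n)" for n
    by (induction n) (auto simp: P0 PS intro: AC_loc_continuous AC_T)
  have T_diff: "T E x - T G x = oriented_integral (\<lambda>s. A s (E s - G s)) x"
    if "continuous_on UNIV E" "continuous_on UNIV G" for E G x
    using integral_diff[OF Ai[OF that(1)] Ai[OF that(2)]]
    by (simp add: T_def oriented_integral_def A_diff)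
  have cd: "continuous_on UNIV (\<lambda>x. E x - G x)"
    if "continuous_on UNIV E" "continuous_on UNIV G" for E G :: "real \<Rightarrow> 'v"
    using that by (rule continuous_on_diff)
  have incr: "norm (P (Suc n) x - P n x) \<le> norm v * (\<bar>K x\<bar> ^ Suc n / fact (Suc n))" for n x
  proof (induction n arbitrary: x)
    case 0
    have "norm (oriented_integral (\<lambda>s. A s v) x) \<le> \<bar>oriented_integral (\<lambda>s. norm v *\<^sub>R a s) x\<bar>"
      by (rule oriented_integral_norm_bound[OF Ai[OF continuous_on_const] ci])
         (use bd in \<open>auto simp: mult.commute\<close>)
    also have "oriented_integral (\<lambda>s. norm v *\<^sub>R a s) x = norm v * K x"
      by (simp add: oriented_integral_def K_def algebra_simps)
    finally show ?case by (simp add: P0 PS T_def abs_mult)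
  next
    case (Suc n)
    \<comment> \<open>Between 0 and \<open>x\<close> the primitive \<open>K\<close> has the sign of
      \<open>x\<close>, so \<open>\<bar>K s\<bar>\<close> can be replaced by
      \<open>\<sigma> * K s\<close> and the signed power formula integrates it.\<close>
    define \<sigma> where "\<sigma> = (if 0 \<le> x then 1 else (-1)::real)"
    define g where "g = (\<lambda>s. (norm v * \<sigma> ^ Suc n) *\<^sub>R (a s * (K s ^ Suc n / fact (Suc n))))"
    have gi: "g integrable_on {b..c}" for b c
      unfolding g_def K_def by (intro integrable_cmul oriented_integral_power(1)[OF a])
    have og: "oriented_integral g x = (norm v * \<sigma> ^ Suc n) * (K x ^ Suc (Suc n) / fact (Suc (Suc n)))"
      unfolding g_def oriented_integral_scaleR K_def oriented_integral_power(2)[OF a] by simp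
    have "norm (P (Suc (Suc n)) x - P (Suc n) x) = norm (oriented_integral (\<lambda>s. A s (P (Suc n) s - P n s)) x)"
      unfolding PS[of "Suc n"] PS[of n] by (subst T_diff) (auto simp: PS[symmetric] contP)
    also have "\<dots> \<le> \<bar>oriented_integral g x\<bar>"
    proof (rule oriented_integral_norm_bound[OF Ai[OF cd[OF contP contP]] gi])
      fix s assume s: "min 0 x \<le> s" "s \<le> max 0 x"
      have "norm (A s (P (Suc n) s - P n s)) \<le> a s * (norm v * (\<bar>K s\<bar> ^ Suc n / fact (Suc n)))"
        by (rule order_trans[OF bd mult_left_mono[OF Suc a0]])
      also have "\<bar>K s\<bar> = \<sigma> * K s" using K_sign[OF s] by (simp add: \<sigma>_def)
      finally show "norm (A s (P (Suc n) s - P n s)) \<le> g s"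
        by (simp add: g_def power_mult_distrib algebra_simps del: power_Suc fact_Suc)
    qed
    also have "\<dots> = norm v * (\<bar>K x\<bar> ^ Suc (Suc n) / fact (Suc (Suc n)))"
      unfolding og by (simp add: abs_mult power_abs \<sigma>_def del: fact_Suc)
    finally show ?case .
  qed
  \<comment> \<open>The limit of the iterates is written as a telescoping series, to which the
    Weierstrass M-test applies.\<close>
  define E where "E = (\<lambda>x. v + (\<Sum>n. P (Suc n) x - P n x))"
  have lim: "uniform_limit {-X..X} P E sequentially" for X
  proof -
    have "bounded (K ` {-X..X})"
      using contK by (auto intro!: compact_imp_bounded compact_continuous_image intro: continuous_on_subset)
    then obtain M where M: "\<And>x. x \<in> {-X..X} \<Longrightarrow> \<bar>K x\<bar> \<le> M" unfolding bounded_iff by (metis image_eqI real_norm_def)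
    have "summable (\<lambda>n. inverse (fact n) * M ^ n)" by (rule summable_exp)
    then have "summable (\<lambda>n. inverse (fact (Suc n)) * M ^ Suc n)" by (subst summable_Suc_iff)
    then have "summable (\<lambda>n. norm v * (inverse (fact (Suc n)) * M ^ Suc n))" by (rule summable_mult)
    then have sm: "summable (\<lambda>n. norm v * (M ^ Suc n / fact (Suc n)))" by (simp only: divide_inverse mult.commute)
    have "uniform_limit {-X..X} (\<lambda>n x. \<Sum>i<n. P (Suc i) x - P i x) (\<lambda>x. \<Sum>i. P (Suc i) x - P i x) sequentially"
    proof (rule Weierstrass_m_test[OF _ sm])
      fix n x assume "x \<in> {-X..X}"
      then have "\<bar>K x\<bar> ^ Suc n / fact (Suc n) \<le> M ^ Suc n / fact (Suc n)"
        by (intro divide_right_mono power_mono M) auto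
      then show "norm (P (Suc n) x - P n x) \<le> norm v * (M ^ Suc n / fact (Suc n))"
        using incr[of n x] by (meson order_trans mult_left_mono norm_ge_zero)
    qed
    then have "uniform_limit {-X..X} (\<lambda>n x. v + (\<Sum>i<n. P (Suc i) x - P i x)) E sequentially"
      unfolding E_def by (intro uniform_limit_add uniform_limit_const)
    moreover have "v + (\<Sum>i<n. P (Suc i) x - P i x) = P n x" for n x
      by (simp add: sum_lessThan_telescope[of "\<lambda>i. P i x"] P0)
    ultimately show ?thesis by simp
  qed
  have contE: "continuous_on UNIV E"
  proof -
    have "isCont E x" for x
    proof -
      have "continuous_on {-(\<bar>x\<bar>+1)..\<bar>x\<bar>+1} E"
        by (rule uniform_limit_theorem[OF _ lim])
           (auto intro!: always_eventually continuous_on_subset[OF contP])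
      then have "continuous_on {-(\<bar>x\<bar>+1)<..<\<bar>x\<bar>+1} E" by (rule continuous_on_subset) auto
      then show ?thesis
        by (rule continuous_on_interior) (auto simp: interior_open)
    qed
    then show ?thesis by (simp add: continuous_on_eq_continuous_at)
  qed
  have fix_E: "E x = T E x" for x
  proof -
    have "(\<lambda>n. T (P n) x) \<longlonglongrightarrow> T E x"
    proof (rule LIMSEQ_I)
      fix e :: real
      assume "e > 0"
      \<comment> \<open>Closeness \<open>e'\<close> of the iterates on the segment between 0 and
        \<open>x\<close> becomes \<open>e' * \<bar>K x\<bar>\<close>, less than \<open>e\<close>,
        after one application of \<open>T\<close>.\<close>
      define e' where "e' = e / (\<bar>K x\<bar> + 1)"
      have "e' > 0" using \<open>e > 0\<close> by (simp add: e'_def)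
      obtain m where m: "\<And>n y. n \<ge> m \<Longrightarrow> y \<in> {-\<bar>x\<bar>..\<bar>x\<bar>} \<Longrightarrow> dist (P n y) (E y) < e'"
        using uniform_limitD[OF lim \<open>e' > 0\<close>, of "\<bar>x\<bar>"] unfolding eventually_sequentially by blast
      have "norm (T (P n) x - T E x) < e" if "n \<ge> m" for n
      proof -
        have "norm (T (P n) x - T E x) \<le> \<bar>oriented_integral (\<lambda>s. e' *\<^sub>R a s) x\<bar>"
          unfolding T_diff[OF contP contE]
        proof (rule oriented_integral_norm_bound[OF Ai[OF cd[OF contP contE]]])
          fix s assume "min 0 x \<le> s" "s \<le> max 0 x"
          then have "dist (P n s) (E s) < e'" using that by (intro m) (auto simp: min_def max_def split: if_splits)
          then have "norm (P n s - E s) \<le> e'" by (simp add: dist_norm)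
          then have "a s * norm (P n s - E s) \<le> a s * e'" by (rule mult_left_mono[OF _ a0])
          then show "norm (A s (P n s - E s)) \<le> e' *\<^sub>R a s"
            using bd[of s "P n s - E s"] by (simp add: mult.commute)
        qed (rule ci)
        also have "oriented_integral (\<lambda>s. e' *\<^sub>R a s) x = e' * K x"
          by (simp add: oriented_integral_def K_def algebra_simps)
        also have "\<bar>e' * K x\<bar> < e"
          using \<open>e > 0\<close> by (simp add: e'_def abs_mult field_simps)
        finally show ?thesis .
      qed
      then show "\<exists>no. \<forall>n\<ge>no. norm (T (P n) x - T E x) < e" by blast
    qed
    moreover have "(\<lambda>n. P n x) \<longlonglongrightarrow> E x"
      by (rule tendsto_uniform_limitI[OF lim[of "\<bar>x\<bar>"]]) auto
    ultimately show ?thesis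
      unfolding PS[symmetric] using LIMSEQ_unique LIMSEQ_Suc by blast
  qed
  \<comment> \<open>As a fixed point of \<open>T\<close>, \<open>E\<close> is an indefinite
    integral; this gives both its absolute continuity and its derivative.\<close>
  then have E_T: "E = T E" by auto
  show ?thesis
  proof (rule that)
    show "AC_loc E" using AC_T[OF contE] E_T by simp
    show "E 0 = v" using fix_E[of 0] by (simp add: T_def oriented_integral_def)
    show "AE x in lborel. (E has_vector_derivative A x (E x)) (at x)"
      by (rule AE_has_vector_derivative_indefinite_integral[OF Ai[OF contE]])
         (use Td[OF _ contE] E_T in simp)
  qed
qed

section \<open>The Dirac system and its resolvent\<close>

text \<open>The equation (M(q) - z) F = G, solved for the derivative of \<open>F\<close>.\<close>

definition solves :: "(real \<Rightarrow> complex) \<Rightarrow> complex \<Rightarrow> C2fun \<Rightarrow> C2fun \<Rightarrow> bool" where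
  "solves q z G F \<longleftrightarrow> AC_loc F \<and>
     (AE x in lborel. (F has_vector_derivative
        (- \<i> * z * fst (F x) + q x * snd (F x) - \<i> * fst (G x),
         \<i> * z * snd (F x) - cnj (q x) * fst (F x) + \<i> * snd (G x))) (at x))"

text \<open>Unlike \<open>wave_function\<close> this admits the zero function, so that solutions
  form a vector space.\<close>

abbreviation solution :: "(real \<Rightarrow> complex) \<Rightarrow> complex \<Rightarrow> C2fun \<Rightarrow> bool" where
  "solution q z \<equiv> solves q z (\<lambda>_. 0)"

definition wronskian :: "complex \<times> complex \<Rightarrow> complex \<times> complex \<Rightarrow> complex" where
  "wronskian u v = fst u * snd v - snd u * fst v"

lemma norm_cscale: "norm (cscale c v) = norm c * norm v"
proof -
  have "(norm (cscale c v))\<^sup>2 = (norm c * norm v)\<^sup>2"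
    by (simp add: cscale_def norm_prod_def norm_mult power_mult_distrib algebra_simps)
  then show ?thesis by (simp add: power2_eq_iff_nonneg)
qed

lemma wave_function_iff: "wave_function q z \<Psi> \<longleftrightarrow> solution q z \<Psi> \<and> (\<exists>x. \<Psi> x \<noteq> 0)"
  unfolding wave_function_def solves_def by simp blast

lemma solves_continuous: "solves q z G F \<Longrightarrow> continuous_on UNIV F"
  unfolding solves_def using AC_loc_continuous by blast

lemma Dq_graph_solves:
  "Dq_graph q F (\<lambda>x. G x + cscale z (F x)) \<Longrightarrow> solves q z G F"
  unfolding Dq_graph_def solves_def
proof (elim conjE, intro conjI)
  assume "AE x in lborel. \<exists>F'. (F has_vector_derivative F') (at x) \<and> G x + cscale z (F x) = Mq q x (F x) F'"
  then show "AE x in lborel. (F has_vector_derivative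
        (- \<i> * z * fst (F x) + q x * snd (F x) - \<i> * fst (G x),
         \<i> * z * snd (F x) - cnj (q x) * fst (F x) + \<i> * snd (G x))) (at x)"
  proof eventually_elim
    case (elim x)
    then obtain F' where F': "(F has_vector_derivative F') (at x)" "G x + cscale z (F x) = Mq q x (F x) F'" by blast
    have "fst (G x) + z * fst (F x) = \<i> * (fst F' - q x * snd (F x))"
      "snd (G x) + z * snd (F x) = \<i> * (- cnj (q x) * fst (F x) - snd F')"
      using arg_cong[OF F'(2), of fst] arg_cong[OF F'(2), of snd] by (simp_all add: Mq_def cscale_def)
    then have "- \<i> * (fst (G x) + z * fst (F x)) = fst F' - q x * snd (F x)"
      "- \<i> * (snd (G x) + z * snd (F x)) = - cnj (q x) * fst (F x) - snd F'"
      by simp_all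
    then have "F' = (- \<i> * z * fst (F x) + q x * snd (F x) - \<i> * fst (G x),
         \<i> * z * snd (F x) - cnj (q x) * fst (F x) + \<i> * snd (G x))"
      by (simp add: prod_eq_iff algebra_simps)
    then show ?case using F'(1) by simp
  qed
qed

lemma solution_imp_Dq_graph:
  assumes "solution q z F" "L2_on UNIV F"
  shows "Dq_graph q F (\<lambda>x. cscale z (F x))"
  unfolding Dq_graph_def
proof (intro conjI)
  have "(\<lambda>x. cscale z (F x)) \<in> borel_measurable borel"
    unfolding cscale_def
    by (intro borel_measurable_continuous_onI continuous_intros solves_continuous[OF assms(1)])
  then show "L2_on UNIV (\<lambda>x. cscale z (F x))"
    using assms(2) unfolding L2_on_def norm_cscale
    by (simp add: set_borel_measurable_def set_integrable_def power_mult_distrib)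
  show "AE x in lborel. \<exists>F'. (F has_vector_derivative F') (at x) \<and> cscale z (F x) = Mq q x (F x) F'"
    using assms(1)[unfolded solves_def, THEN conjunct2]
  proof eventually_elim
    case (elim x)
    then show ?case
      by (intro exI conjI) (assumption, simp add: Mq_def cscale_def algebra_simps flip: mult.assoc)
  qed
qed (use assms in \<open>auto simp: solves_def\<close>)

text \<open>The coefficient matrix of the system has trace zero, so in the derivative of the
  determinant all terms with \<open>z\<close> and \<open>q\<close> cancel and only the source is
  left.\<close>

lemma wronskian_green:
  assumes \<Phi>: "solution q z \<Phi>" and F: "solves q z G F" and "x \<le> y"
  shows "((\<lambda>s. \<i> * (fst (\<Phi> s) * snd (G s) + snd (\<Phi> s) * fst (G s))) has_integral
     (wronskian (\<Phi> y) (F y) - wronskian (\<Phi> x) (F x))) {x..y}"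
proof (rule AC_loc_has_integral[OF _ \<open>x \<le> y\<close>])
  have AC: "AC_loc \<Phi>" "AC_loc F" using \<Phi> F by (auto simp: solves_def)
  show "AC_loc (\<lambda>x. wronskian (\<Phi> x) (F x))"
    unfolding wronskian_def
    by (intro AC_loc_diff AC_loc_mult AC_loc_bounded_linear[OF AC(1) bounded_linear_fst]
        AC_loc_bounded_linear[OF AC(2) bounded_linear_snd] AC_loc_bounded_linear[OF AC(1) bounded_linear_snd]
        AC_loc_bounded_linear[OF AC(2) bounded_linear_fst])
  show "AE s in lborel. s \<in> {x<..<y} \<longrightarrow> ((\<lambda>x. wronskian (\<Phi> x) (F x)) has_vector_derivative
      \<i> * (fst (\<Phi> s) * snd (G s) + snd (\<Phi> s) * fst (G s))) (at s)"
    using \<Phi>[unfolded solves_def, THEN conjunct2] F[unfolded solves_def, THEN conjunct2]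
  proof eventually_elim
    case (elim s)
    note d = bounded_linear.has_vector_derivative[OF bounded_linear_fst elim(1)]
      bounded_linear.has_vector_derivative[OF bounded_linear_snd elim(1)]
      bounded_linear.has_vector_derivative[OF bounded_linear_fst elim(2)]
      bounded_linear.has_vector_derivative[OF bounded_linear_snd elim(2)]
    show ?case
      unfolding wronskian_def
      by (rule impI, rule has_vector_derivative_eq_rhs,
          rule has_vector_derivative_diff[OF has_vector_derivative_mult[OF d(1) d(4)] has_vector_derivative_mult[OF d(2) d(3)]])
         (simp add: algebra_simps)
  qed
qed

text \<open>The interval \<open>S\<close> is kept general: half lines beside a compactly supported
  source are needed as well as the whole line.\<close>

lemma wronskian_constant:
  assumes "solution q z \<Phi>" "solves q z G F" "is_interval S" "\<And>s. s \<in> S \<Longrightarrow> G s = 0" "x \<in> S" "y \<in> S"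
  shows "wronskian (\<Phi> x) (F x) = wronskian (\<Phi> y) (F y)"
proof -
  have *: "wronskian (\<Phi> x) (F x) = wronskian (\<Phi> y) (F y)" if "x \<in> S" "y \<in> S" "x \<le> y" for x y
  proof -
    have "{x..y} \<subseteq> S" using mem_is_interval_1_I[OF assms(3) that(1,2)] by auto
    then have "((\<lambda>s. \<i> * (fst (\<Phi> s) * snd (G s) + snd (\<Phi> s) * fst (G s))) has_integral 0) {x..y}"
      using assms(4) by (intro has_integral_is_0) auto
    from has_integral_unique[OF this wronskian_green[OF assms(1,2) that(3)]]
    show ?thesis by simp
  qed
  then show ?thesis using assms(5,6) by (metis linear)
qed

lemma solution_lincomb:
  assumes "solution q z \<Phi>" "solution q z \<Psi>"
  shows "solution q z (\<lambda>x. cscale a (\<Phi> x) + cscale b (\<Psi> x))"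
proof -
  have bl: "bounded_linear (cscale c)" for c
    unfolding cscale_def
    by (intro bounded_linear_Pair bounded_linear_const_mult bounded_linear_fst bounded_linear_snd)
  have "AC_loc (\<lambda>x. cscale a (\<Phi> x) + cscale b (\<Psi> x))"
    using AC_loc_add[OF AC_loc_bounded_linear[OF _ bl] AC_loc_bounded_linear[OF _ bl]] assms
    unfolding solves_def by blast
  moreover have "AE x in lborel. ((\<lambda>x. cscale a (\<Phi> x) + cscale b (\<Psi> x)) has_vector_derivative
     (- \<i> * z * fst (cscale a (\<Phi> x) + cscale b (\<Psi> x)) + q x * snd (cscale a (\<Phi> x) + cscale b (\<Psi> x)) - \<i> * fst (0::complex \<times> complex),
      \<i> * z * snd (cscale a (\<Phi> x) + cscale b (\<Psi> x)) - cnj (q x) * fst (cscale a (\<Phi> x) + cscale b (\<Psi> x)) + \<i> * snd (0::complex \<times> complex))) (at x)"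
    using assms(1)[unfolded solves_def, THEN conjunct2] assms(2)[unfolded solves_def, THEN conjunct2]
  proof eventually_elim
    case (elim x)
    show ?case
      by (rule has_vector_derivative_eq_rhs, rule has_vector_derivative_add[OF
          bounded_linear.has_vector_derivative[OF bl elim(1)] bounded_linear.has_vector_derivative[OF bl elim(2)]])
         (simp add: cscale_def algebra_simps)
  qed
  ultimately show ?thesis by (simp add: solves_def)
qed

section \<open>Existence, uniqueness and continuation of solutions\<close>

lemma L1_loc_absolutely_integrable:
  assumes "L1_loc q"
  shows "q absolutely_integrable_on {b..c}"
  using assms unfolding L1_loc_def set_integrable_def
  by (metis integrable_completion borel_measurable_integrable)

lemma absolutely_integrable_mult_continuous:
  fixes g E :: "real \<Rightarrow> complex"
  assumes "g absolutely_integrable_on {b..c}" "continuous_on UNIV E"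
  shows "(\<lambda>x. g x * E x) absolutely_integrable_on {b..c}"
proof -
  have c: "continuous_on {b..c} E" using assms(2) by (rule continuous_on_subset) simp
  have "(\<lambda>x. E x * g x) absolutely_integrable_on {b..c}"
  proof (rule absolutely_integrable_bounded_measurable_product[where h="\<lambda>x y. x * y", OF _ _ _ _ assms(1)])
    show "bilinear (\<lambda>x y. x * y :: complex)" by (rule bilinear_times)
    show "E \<in> borel_measurable (lebesgue_on {b..c})"
      by (rule continuous_imp_measurable_on_sets_lebesgue[OF c]) simp
    show "bounded (E ` {b..c})"
      by (intro compact_imp_bounded compact_continuous_image c) simp
  qed simp
  then show ?thesis by (simp add: mult.commute)
qed

lemma solution_exists:
  assumes q: "L1_loc q"
  obtains E where "solution q z E" "E 0 = v"
proof -
  define A where "A = (\<lambda>s v. (- \<i> * z * fst v + q s * snd v, \<i> * z * snd v - cnj (q s) * fst v))"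
  \<comment> \<open>The diagonal part of the system multiplies norms by \<open>norm z\<close> and
    the off-diagonal part by \<open>norm (q s)\<close>; the triangle inequality adds the
    two.\<close>
  define a where "a = (\<lambda>s. norm z + norm (q s))"
  have nq: "(\<lambda>s. norm (q s)) absolutely_integrable_on {b..c}" for b c
    by (rule absolutely_integrable_norm[OF L1_loc_absolutely_integrable[OF q], unfolded o_def])
  have cq: "(\<lambda>s. cnj (q s)) absolutely_integrable_on {b..c}" for b c
    by (rule absolutely_integrable_linear[OF L1_loc_absolutely_integrable[OF q] bounded_linear_cnj, unfolded o_def])
  have "AC_loc F \<and> F 0 = v \<and> (AE x in lborel. (F has_vector_derivative A x (F x)) (at x)) \<Longrightarrow> thesis" for F
    using that[of F] by (simp add: solves_def A_def)
  moreover obtain F where "AC_loc F" "F 0 = v" "AE x in lborel. (F has_vector_derivative A x (F x)) (at x)"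
  proof (rule linear_ode_exists[of A a v])
    show "A s (u - w) = A s u - A s w" for s u w by (simp add: A_def algebra_simps)
    show "norm (A s w) \<le> a s * norm w" for s w
    proof -
      have "A s w = (- \<i> * z * fst w, \<i> * z * snd w) + (q s * snd w, - (cnj (q s) * fst w))"
        by (simp add: A_def)
      also have "norm \<dots> \<le> norm (- \<i> * z * fst w, \<i> * z * snd w) + norm (q s * snd w, - (cnj (q s) * fst w))"
        by (rule norm_triangle_ineq)
      also have "norm (- \<i> * z * fst w, \<i> * z * snd w) = norm z * norm w"
      proof -
        have "(norm (- \<i> * z * fst w, \<i> * z * snd w))\<^sup>2 = (norm z * norm w)\<^sup>2"
          by (simp add: norm_prod_def norm_mult power_mult_distrib algebra_simps)
        then show ?thesis by (simp add: power2_eq_iff_nonneg)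
      qed
      also have "norm (q s * snd w, - (cnj (q s) * fst w)) = norm (q s) * norm w"
      proof -
        have "(norm (q s * snd w, - (cnj (q s) * fst w)))\<^sup>2 = (norm (q s) * norm w)\<^sup>2"
          by (simp add: norm_prod_def norm_mult power_mult_distrib algebra_simps)
        then show ?thesis by (simp add: power2_eq_iff_nonneg)
      qed
      finally show ?thesis by (simp add: a_def algebra_simps)
    qed
    show "a absolutely_integrable_on {b..c}" for b c
      unfolding a_def by (intro set_integral_add(1) nq absolutely_integrable_continuous_real) simp
    show "a s \<ge> 0" for s by (simp add: a_def)
    show "(\<lambda>s. A s (E s)) absolutely_integrable_on {b..c}" if E: "continuous_on UNIV E" for E b c
    proof -
      have c1: "continuous_on UNIV (\<lambda>s. fst (E s))" "continuous_on UNIV (\<lambda>s. snd (E s))"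
        using E by (auto intro: continuous_intros)
      have f1: "(\<lambda>s. - \<i> * z * fst (E s)) absolutely_integrable_on {b..c}"
        "(\<lambda>s. \<i> * z * snd (E s)) absolutely_integrable_on {b..c}"
        by (intro absolutely_integrable_continuous_real continuous_on_mult continuous_on_const
            continuous_on_subset[OF c1(1)] continuous_on_subset[OF c1(2)] subset_UNIV)+
      have 1: "(\<lambda>s. - \<i> * z * fst (E s) + q s * snd (E s)) absolutely_integrable_on {b..c}"
        by (intro set_integral_add(1) f1 absolutely_integrable_mult_continuous L1_loc_absolutely_integrable q c1)
      have 2: "(\<lambda>s. \<i> * z * snd (E s) - cnj (q s) * fst (E s)) absolutely_integrable_on {b..c}"
        by (intro set_integral_diff(1) f1 absolutely_integrable_mult_continuous cq c1)
      have b1: "bounded_linear (\<lambda>u::complex. (u, 0::complex))" "bounded_linear (\<lambda>u::complex. (0::complex, u))"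
        by (intro bounded_linear_Pair bounded_linear_ident bounded_linear_zero)+
      have "(\<lambda>s. (- \<i> * z * fst (E s) + q s * snd (E s), 0) + (0, \<i> * z * snd (E s) - cnj (q s) * fst (E s)))
          absolutely_integrable_on {b..c}"
        using absolutely_integrable_linear[OF 1 b1(1), unfolded o_def] absolutely_integrable_linear[OF 2 b1(2), unfolded o_def]
        by (rule set_integral_add(1))
      then show ?thesis by (simp add: A_def)
    qed
  qed
  ultimately show thesis by blast
qed

text \<open>Cramer's rule for a basis of determinant 1.\<close>

lemma cscale_wronskian_decomp:
  assumes "wronskian u w = 1"
  shows "v = cscale (wronskian v w) u + cscale (wronskian u v) w"
proof -
  have "fst v = fst v * wronskian u w" "snd v = snd v * wronskian u w" using assms by auto
  then show ?thesis
    unfolding wronskian_def cscale_def by (simp add: prod_eq_iff algebra_simps)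
qed

lemma wronskian_commute: "wronskian u v = - wronskian v u"
  by (simp add: wronskian_def)

lemma fundamental_system:
  assumes q: "L1_loc q"
  obtains E1 E2 where "solution q z E1" "solution q z E2" "\<And>x. wronskian (E1 x) (E2 x) = 1"
proof -
  obtain E1 where E1: "solution q z E1" "E1 0 = (1, 0)" using solution_exists[OF q] by blast
  obtain E2 where E2: "solution q z E2" "E2 0 = (0, 1)" using solution_exists[OF q] by blast
  have "wronskian (E1 x) (E2 x) = 1" for x
    using wronskian_constant[OF E1(1) E2(1) is_interval_univ, of x 0] E1(2) E2(2)
    by (simp add: wronskian_def)
  then show thesis using that E1(1) E2(1) by blast
qed

text \<open>The coordinates of \<open>F\<close> in a fundamental system are Wronskians, hence
  constant where the source vanishes. Freezing them at a point of \<open>S\<close> continues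
  \<open>F\<close> from \<open>S\<close> to a solution on the whole line, to which the results on
  solutions then apply.\<close>

lemma solution_extension:
  assumes q: "L1_loc q" and F: "solves q z G F" and S: "is_interval S" "\<And>s. s \<in> S \<Longrightarrow> G s = 0"
  obtains \<Xi> where "solution q z \<Xi>" "\<And>x. x \<in> S \<Longrightarrow> \<Xi> x = F x"
proof (cases "S = {}")
  case True
  then show ?thesis using that solution_exists[OF q] by blast
next
  case False
  then obtain b where b: "b \<in> S" by blast
  obtain E1 E2 where E: "solution q z E1" "solution q z E2" and W: "\<And>x. wronskian (E1 x) (E2 x) = 1"
    using fundamental_system[OF q] by blast
  show ?thesis
  proof (rule that[OF solution_lincomb[OF E]])
    fix x assume x: "x \<in> S"
    have "wronskian (E1 b) (F b) = wronskian (E1 x) (F x)" "wronskian (E2 b) (F b) = wronskian (E2 x) (F x)"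
      using wronskian_constant[OF E(1) F S b x] wronskian_constant[OF E(2) F S b x] by auto
    then show "cscale (wronskian (F b) (E2 b)) (E1 x) + cscale (wronskian (E1 b) (F b)) (E2 x) = F x"
      using cscale_wronskian_decomp[OF W, of "F x" x] wronskian_commute by metis
  qed
qed

text \<open>This is uniqueness for the initial value problem: a zero at one point annihilates both
  constant Wronskians with a fundamental system, and these are the coordinates everywhere.\<close>

lemma solution_nonzero:
  assumes q: "L1_loc q" and F: "wave_function q z \<Phi>"
  shows "\<Phi> x \<noteq> 0"
proof
  assume "\<Phi> x = 0"
  obtain E1 E2 where E: "solution q z E1" "solution q z E2" and W: "\<And>x. wronskian (E1 x) (E2 x) = 1"
    using fundamental_system[OF q] by blast
  have S: "solution q z \<Phi>" using F by (simp add: wave_function_iff)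
  have "wronskian (E1 y) (\<Phi> y) = 0" "wronskian (E2 y) (\<Phi> y) = 0" for y
    using wronskian_constant[OF E(1) S is_interval_univ, of y x] wronskian_constant[OF E(2) S is_interval_univ, of y x]
      \<open>\<Phi> x = 0\<close> by (simp_all add: wronskian_def)
  then have "\<Phi> y = 0" for y
    using cscale_wronskian_decomp[OF W, of "\<Phi> y" y] wronskian_commute[of "\<Phi> y" "E2 y"] by (simp add: cscale_def zero_prod_def)
  then show False using F by (auto simp: wave_function_iff)
qed

lemma solution_proportional:
  assumes q: "L1_loc q" and \<Psi>: "wave_function q z \<Psi>" and \<Phi>: "solution q z \<Phi>"
    and W0: "wronskian (\<Psi> x) (\<Phi> x) = 0"
  obtains c where "\<And>y. \<Phi> y = cscale c (\<Psi> y)"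
proof -
  have S: "solution q z \<Psi>" using \<Psi> by (simp add: wave_function_iff)
  have nz: "\<Psi> x \<noteq> 0" by (rule solution_nonzero[OF q \<Psi>])
  \<comment> \<open>The quotient is taken in a nonzero component of \<open>\<Psi> x\<close>; the
    vanishing determinant makes the other component agree.\<close>
  define c where "c = (if fst (\<Psi> x) = 0 then snd (\<Phi> x) / snd (\<Psi> x) else fst (\<Phi> x) / fst (\<Psi> x))"
  have cx: "\<Phi> x = cscale c (\<Psi> x)"
    using nz W0 by (auto simp: c_def cscale_def prod_eq_iff wronskian_def field_simps split: if_splits)
  have "solution q z (\<lambda>y. cscale 1 (\<Phi> y) + cscale (- c) (\<Psi> y))"
    by (rule solution_lincomb[OF \<Phi> S])
  moreover have "cscale 1 (\<Phi> x) + cscale (- c) (\<Psi> x) = 0"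
    using cx by (simp add: cscale_def prod_eq_iff)
  ultimately have "cscale 1 (\<Phi> y) + cscale (- c) (\<Psi> y) = 0" for y
    using solution_nonzero[OF q] unfolding wave_function_iff by blast
  then have "\<Phi> y = cscale c (\<Psi> y)" for y
    by (simp add: cscale_def prod_eq_iff add_eq_0_iff)
  then show thesis by (rule that)
qed

section \<open>Pointwise control of solutions by their mass, and decay at the ends\<close>

lemma set_integral_mono_set_nonneg:
  fixes u :: "'a \<Rightarrow> real"
  assumes "set_integrable M B u" "A \<in> sets M" "A \<subseteq> B" "\<And>x. u x \<ge> 0"
  shows "(LINT x:A|M. u x) \<le> (LINT x:B|M. u x)"
  using set_integrable_subset[OF assms(1-3)] assms(1,3,4)
  unfolding set_lebesgue_integral_def set_integrable_def
  by (intro integral_mono) (auto simp: indicator_def)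

text \<open>The potential matrix with entries \<open>q\<close> and \<open>- cnj q\<close> is
  skew-Hermitian, so \<open>q\<close> drops out of the derivative of the squared norm. The remainder
  is at most \<open>norm (z - cnj z)\<close>, that is 2 |Im z|, times the squared norm.\<close>

lemma solution_norm_variation:
  assumes \<Psi>: "solution q z \<Psi>" and "x \<le> y"
  shows "\<bar>(norm (\<Psi> y))\<^sup>2 - (norm (\<Psi> x))\<^sup>2\<bar> \<le> norm (z - cnj z) * (LINT s:{x..y}|lborel. (norm (\<Psi> s))\<^sup>2)"
proof -
  \<comment> \<open>As a complex polynomial in the components and their conjugates, the squared norm
    is accessible to the closure properties and to the product rule.\<close>
  define U where "U = (\<lambda>s. fst (\<Psi> s) * cnj (fst (\<Psi> s)) + snd (\<Psi> s) * cnj (snd (\<Psi> s)))"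
  define D where "D = (\<lambda>s. - \<i> * (z - cnj z) * (fst (\<Psi> s) * cnj (fst (\<Psi> s)) - snd (\<Psi> s) * cnj (snd (\<Psi> s))))"
  have U: "U s = of_real ((norm (\<Psi> s))\<^sup>2)" for s
    by (simp add: U_def norm_prod_def complex_norm_square[symmetric])
  have AC: "AC_loc \<Psi>" using \<Psi> by (simp add: solves_def)
  note AC12 = AC_loc_bounded_linear[OF AC bounded_linear_fst] AC_loc_bounded_linear[OF AC bounded_linear_snd]
  have "AC_loc U"
    unfolding U_def
    by (intro AC_loc_add AC_loc_mult AC12 AC_loc_bounded_linear[OF AC12(1) bounded_linear_cnj]
        AC_loc_bounded_linear[OF AC12(2) bounded_linear_cnj])
  moreover have "AE s in lborel. s \<in> {x<..<y} \<longrightarrow> (U has_vector_derivative D s) (at s)"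
    using \<Psi>[unfolded solves_def, THEN conjunct2]
  proof eventually_elim
    case (elim s)
    note d1 = bounded_linear.has_vector_derivative[OF bounded_linear_fst elim]
    note d2 = bounded_linear.has_vector_derivative[OF bounded_linear_snd elim]
    note c1 = bounded_linear.has_vector_derivative[OF bounded_linear_cnj d1]
    note c2 = bounded_linear.has_vector_derivative[OF bounded_linear_cnj d2]
    show ?case
      unfolding U_def
      by (rule impI, rule has_vector_derivative_eq_rhs,
          rule has_vector_derivative_add[OF has_vector_derivative_mult[OF d1 c1] has_vector_derivative_mult[OF d2 c2]])
         (simp add: D_def algebra_simps)
  qed
  ultimately have hi: "(D has_integral (U y - U x)) {x..y}"
    by (rule AC_loc_has_integral[OF _ \<open>x \<le> y\<close>])
  have u: "set_integrable lborel {x..y} (\<lambda>s. (norm (\<Psi> s))\<^sup>2)"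
    by (intro borel_integrable_atLeastAtMost' continuous_intros continuous_on_subset[OF solves_continuous[OF \<Psi>]]) simp
  have "norm (integral {x..y} D) \<le> integral {x..y} (\<lambda>s. norm (z - cnj z) *\<^sub>R (norm (\<Psi> s))\<^sup>2)"
  proof (rule integral_norm_bound_integral)
    show "D integrable_on {x..y}" using hi by (rule has_integral_integrable)
    show "(\<lambda>s. norm (z - cnj z) *\<^sub>R (norm (\<Psi> s))\<^sup>2) integrable_on {x..y}"
      by (rule integrable_cmul[OF set_borel_integral_eq_integral(1)[OF u]])
    fix s
    have "norm (fst (\<Psi> s) * cnj (fst (\<Psi> s)) - snd (\<Psi> s) * cnj (snd (\<Psi> s)))
       \<le> norm (fst (\<Psi> s) * cnj (fst (\<Psi> s))) + norm (snd (\<Psi> s) * cnj (snd (\<Psi> s)))"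
      by (rule norm_triangle_ineq4)
    also have "\<dots> = (norm (\<Psi> s))\<^sup>2"
      by (simp add: norm_prod_def norm_mult power2_eq_square)
    finally show "norm (D s) \<le> norm (z - cnj z) *\<^sub>R (norm (\<Psi> s))\<^sup>2"
      by (simp add: D_def norm_mult mult_left_mono)
  qed
  also have "\<dots> = norm (z - cnj z) * (LINT s:{x..y}|lborel. (norm (\<Psi> s))\<^sup>2)"
    using set_borel_integral_eq_integral(2)[OF u] by simp
  also have "norm (integral {x..y} D) = \<bar>(norm (\<Psi> y))\<^sup>2 - (norm (\<Psi> x))\<^sup>2\<bar>"
    unfolding integral_unique[OF hi] U by (simp only: of_real_diff[symmetric] norm_of_real)
  finally show ?thesis .
qed

lemma norm_square_set_integrable:
  fixes \<Psi> :: C2fun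
  assumes "continuous_on UNIV \<Psi>"
  shows "set_integrable lborel {a..b} (\<lambda>s. (norm (\<Psi> s))\<^sup>2)"
  by (intro borel_integrable_atLeastAtMost' continuous_intros continuous_on_subset[OF assms]) simp

text \<open>On an interval of length 1 the minimum of the squared norm is at most the mass, and any
  other value differs from it by at most \<open>norm (z - cnj z)\<close> times the mass.\<close>

lemma solution_pointwise_bound:
  assumes \<Psi>: "solution q z \<Psi>" and x: "c \<le> x" "x \<le> c + 1"
  shows "(norm (\<Psi> x))\<^sup>2 \<le> (1 + norm (z - cnj z)) * (LINT s:{c..c+1}|lborel. (norm (\<Psi> s))\<^sup>2)"
proof -
  define u where "u = (\<lambda>s. (norm (\<Psi> s))\<^sup>2)"
  define I where "I = (LINT s:{c..c+1}|lborel. u s)"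
  have cont: "continuous_on {c..c+1} u"
    unfolding u_def by (intro continuous_intros continuous_on_subset[OF solves_continuous[OF \<Psi>]]) simp
  have ui: "set_integrable lborel {a..b} u" for a b
    unfolding u_def by (rule norm_square_set_integrable[OF solves_continuous[OF \<Psi>]])
  obtain y where y: "y \<in> {c..c+1}" "\<And>s. s \<in> {c..c+1} \<Longrightarrow> u y \<le> u s"
    using continuous_attains_inf[OF compact_Icc _ cont] by auto
  have sub: "(LINT s:{a..b}|lborel. u s) \<le> I" if "c \<le> a" "b \<le> c + 1" for a b
    unfolding I_def by (rule set_integral_mono_set_nonneg[OF ui]) (use that in \<open>auto simp: u_def\<close>)
  have "integral {c..c+1} (\<lambda>_. u y) \<le> integral {c..c+1} u"
    using y by (intro integral_le set_borel_integral_eq_integral(1)[OF ui]) auto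
  then have "u y \<le> I"
    unfolding I_def set_borel_integral_eq_integral(2)[OF ui] by simp
  moreover have "\<bar>u x - u y\<bar> \<le> norm (z - cnj z) * I"
  proof -
    have "\<bar>u x - u y\<bar> \<le> norm (z - cnj z) * (LINT s:{min x y..max x y}|lborel. u s)"
      using solution_norm_variation[OF \<Psi>, of x y] solution_norm_variation[OF \<Psi>, of y x]
      by (cases "x \<le> y") (auto simp: u_def min_def max_def abs_minus_commute)
    also have "\<dots> \<le> norm (z - cnj z) * I"
      using x y by (intro mult_left_mono sub) auto
    finally show ?thesis .
  qed
  ultimately have "u x \<le> I + norm (z - cnj z) * I" by (auto simp: abs_le_iff)
  then show ?thesis by (simp add: u_def I_def algebra_simps)
qed

text \<open>Continuity takes care of compact pieces, so the point where a half line is cut is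
  immaterial.\<close>

lemma set_integrable_right_tail:
  fixes \<Psi> :: C2fun
  assumes "continuous_on UNIV \<Psi>" "set_integrable lborel {b..} (\<lambda>x. (norm (\<Psi> x))\<^sup>2)"
  shows "set_integrable lborel {R..} (\<lambda>x. (norm (\<Psi> x))\<^sup>2)"
proof -
  have "set_integrable lborel ({R..b} \<union> {b..}) (\<lambda>x. (norm (\<Psi> x))\<^sup>2)"
    by (rule set_integrable_Un[OF norm_square_set_integrable[OF assms(1)] assms(2)]) auto
  then show ?thesis by (rule set_integrable_subset) auto
qed

lemma set_integrable_left_tail:
  fixes \<Psi> :: C2fun
  assumes "continuous_on UNIV \<Psi>" "set_integrable lborel {..b} (\<lambda>x. (norm (\<Psi> x))\<^sup>2)"
  shows "set_integrable lborel {..R} (\<lambda>x. (norm (\<Psi> x))\<^sup>2)"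
proof -
  have "set_integrable lborel ({..b} \<union> {b..R}) (\<lambda>x. (norm (\<Psi> x))\<^sup>2)"
    by (rule set_integrable_Un[OF assms(2) norm_square_set_integrable[OF assms(1)]]) auto
  then show ?thesis by (rule set_integrable_subset) auto
qed

lemma set_integral_combine:
  fixes \<Psi> :: C2fun
  assumes "continuous_on UNIV \<Psi>" "a \<le> b" "b \<le> c"
  shows "(LINT s:{a..c}|lborel. (norm (\<Psi> s))\<^sup>2)
     = (LINT s:{a..b}|lborel. (norm (\<Psi> s))\<^sup>2) + (LINT s:{b..c}|lborel. (norm (\<Psi> s))\<^sup>2)"
  unfolding set_borel_integral_eq_integral(2)[OF norm_square_set_integrable[OF assms(1)]]
  using Henstock_Kurzweil_Integration.integral_combine[OF assms(2,3)
      set_borel_integral_eq_integral(1)[OF norm_square_set_integrable[OF assms(1)]]] by simp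

lemma tendsto_zero_norm_square:
  fixes \<Psi> :: C2fun
  assumes "((\<lambda>x. (norm (\<Psi> x))\<^sup>2) \<longlongrightarrow> 0) F"
  shows "((\<lambda>x. norm (\<Psi> x)) \<longlongrightarrow> 0) F"
  using tendsto_real_sqrt[OF assms] by simp

text \<open>The mass of the window from \<open>x\<close> to \<open>x + 1\<close> is a difference of
  two values of a convergent primitive, and it dominates the squared norm at
  \<open>x\<close>.\<close>

lemma solution_tendsto_zero_at_top:
  assumes \<Psi>: "solution q z \<Psi>" and int: "set_integrable lborel {b..} (\<lambda>x. (norm (\<Psi> x))\<^sup>2)"
  shows "((\<lambda>x. norm (\<Psi> x)) \<longlongrightarrow> 0) at_top"
proof (rule tendsto_zero_norm_square)
  define u where "u = (\<lambda>s. (norm (\<Psi> s))\<^sup>2)"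
  note c = solves_continuous[OF \<Psi>]
  define J where "J = (\<lambda>x. LINT s:{b..x}|lborel. u s)"
  have J: "(J \<longlongrightarrow> (LINT s:{b..}|lborel. u s)) at_top"
    unfolding J_def u_def by (rule tendsto_set_lebesgue_integral_at_top[OF _ int]) simp
  have J1: "((\<lambda>x. J (x + 1)) \<longlongrightarrow> (LINT s:{b..}|lborel. u s)) at_top"
    by (rule filterlim_compose[OF J]) (rule filterlim_tendsto_add_at_top[OF tendsto_const filterlim_ident, of 1, simplified add.commute])
  have lim: "((\<lambda>x. (1 + norm (z - cnj z)) * (J (x + 1) - J x)) \<longlongrightarrow> 0) at_top"
    using tendsto_mult_left[OF tendsto_diff[OF J1 J], of "1 + norm (z - cnj z)"] by simp
  have "\<forall>\<^sub>F x in at_top. u x \<le> (1 + norm (z - cnj z)) * (J (x + 1) - J x)"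
    using eventually_ge_at_top[of b]
  proof eventually_elim
    case (elim x)
    show ?case
      using solution_pointwise_bound[OF \<Psi>, of x x] set_integral_combine[OF c elim, of "x + 1"]
      by (simp add: J_def u_def)
  qed
  then show "(u \<longlongrightarrow> 0) at_top"
    by (intro tendsto_sandwich[OF _ _ tendsto_const lim]) (auto simp: u_def)
qed

lemma solution_tendsto_zero_at_bot:
  assumes \<Psi>: "solution q z \<Psi>" and int: "set_integrable lborel {..b} (\<lambda>x. (norm (\<Psi> x))\<^sup>2)"
  shows "((\<lambda>x. norm (\<Psi> x)) \<longlongrightarrow> 0) at_bot"
proof (rule tendsto_zero_norm_square)
  define u where "u = (\<lambda>s. (norm (\<Psi> s))\<^sup>2)"
  note c = solves_continuous[OF \<Psi>]
  \<comment> \<open>Here the primitive is anchored at the right end \<open>b\<close>, and the window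
    runs from \<open>x - 1\<close> to \<open>x\<close> so as to stay inside
    \<open>{..b}\<close>.\<close>
  define J where "J = (\<lambda>x. LINT s:{x..b}|lborel. u s)"
  have J: "(J \<longlongrightarrow> (LINT s:{..b}|lborel. u s)) at_bot"
    unfolding J_def u_def by (rule tendsto_set_lebesgue_integral_at_bot[OF _ int]) simp
  have "filterlim (\<lambda>x::real. x - 1) at_bot at_bot"
    unfolding filterlim_at_bot by (auto intro!: eventually_at_bot_linorderI[of "_ + 1"] simp: algebra_simps)
  then have J1: "((\<lambda>x. J (x - 1)) \<longlongrightarrow> (LINT s:{..b}|lborel. u s)) at_bot"
    by (rule filterlim_compose[OF J])
  have lim: "((\<lambda>x. (1 + norm (z - cnj z)) * (J (x - 1) - J x)) \<longlongrightarrow> 0) at_bot"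
    using tendsto_mult_left[OF tendsto_diff[OF J1 J], of "1 + norm (z - cnj z)"] by simp
  have "\<forall>\<^sub>F x in at_bot. u x \<le> (1 + norm (z - cnj z)) * (J (x - 1) - J x)"
    using eventually_le_at_bot[of b]
  proof eventually_elim
    case (elim x)
    show ?case
      using solution_pointwise_bound[OF \<Psi>, of "x - 1" x] set_integral_combine[OF c _ elim, of "x - 1"]
      by (simp add: J_def u_def)
  qed
  then show "(u \<longlongrightarrow> 0) at_bot"
    by (intro tendsto_sandwich[OF _ _ tendsto_const lim]) (auto simp: u_def)
qed

text \<open>The pointwise bound read backwards: zero mass would force a zero of \<Phi>. Positivity
  makes the right-hand side of Green's formula nonzero for a source on
  \<open>{0..1}\<close>.\<close>

lemma wave_function_mass_pos:
  assumes "L1_loc q" "wave_function q z \<Phi>"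
  shows "0 < (LINT s:{0..1}|lborel. (norm (\<Phi> s))\<^sup>2)"
proof -
  have "solution q z \<Phi>" using assms(2) by (simp add: wave_function_iff)
  from solution_pointwise_bound[OF this, of 0 0] solution_nonzero[OF assms, of 0]
  have "0 < (1 + norm (z - cnj z)) * (LINT s:{0..1}|lborel. (norm (\<Phi> s))\<^sup>2)"
    by (smt (verit) zero_less_norm_iff zero_less_power norm_ge_zero)
  then show ?thesis by (smt (verit) norm_ge_zero zero_less_mult_pos)
qed

text \<open>The resolvent is applied to a source supported in [a,b] whose pairing with \<open>\<Phi>\<close> in Green's
  formula is the square of its norm. The response solves the homogeneous equation outside [a,b].\<close>
lemma resolvent_response:
  assumes q: "L1_loc q" and z: "z \<in> resolvent_set_Dq q"
  obtains C where "\<And>\<Phi> a b. \<lbrakk>solution q z \<Phi>; a \<le> b\<rbrakk> \<Longrightarrow> \<exists>\<Xi>m \<Xi>p. solution q z \<Xi>m \<and> solution q z \<Xi>p \<and>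
     set_integrable lborel {..a} (\<lambda>x. (norm (\<Xi>m x))\<^sup>2) \<and> set_integrable lborel {b..} (\<lambda>x. (norm (\<Xi>p x))\<^sup>2) \<and>
     wronskian (\<Phi> b) (\<Xi>p b) - wronskian (\<Phi> a) (\<Xi>m a) = \<i> * of_real (LINT x:{a..b}|lborel. (norm (\<Phi> x))\<^sup>2) \<and>
     (LINT x:{b..}|lborel. (norm (\<Xi>p x))\<^sup>2) \<le> C * (LINT x:{a..b}|lborel. (norm (\<Phi> x))\<^sup>2)"
proof -
  obtain C0 where surj: "\<And>G. L2_on UNIV G \<Longrightarrow> \<exists>F. Dq_graph q F (\<lambda>x. G x + cscale z (F x))"
    and bound: "\<And>F G. Dq_graph q F G \<Longrightarrow> L2norm F \<le> C0 * L2norm (\<lambda>x. G x - cscale z (F x))"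
    using z unfolding resolvent_set_Dq_def by blast
  show thesis
  \<comment> \<open>The resolvent bound concerns norms while the claim concerns masses, hence the
    square; nonnegativity of \<open>L2norm F\<close> allows squaring whatever the sign of
    \<open>C0\<close>.\<close>
  proof (rule that[of "C0\<^sup>2"])
    fix \<Phi> and a b :: real
    assume \<Phi>: "solution q z \<Phi>" and ab: "a \<le> b"
    note c = solves_continuous[OF \<Phi>]
    define M where "M = (LINT x:{a..b}|lborel. (norm (\<Phi> x))\<^sup>2)"
    have \<Phi>i: "set_integrable lborel {a..b} (\<lambda>x. (norm (\<Phi> x))\<^sup>2)"
      by (rule norm_square_set_integrable[OF c])
    have M0: "0 \<le> M" unfolding M_def set_lebesgue_integral_def by (rule Bochner_Integration.integral_nonneg) simp
    \<comment> \<open>The open interval makes \<open>G\<close> vanish at \<open>a\<close> and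
      \<open>b\<close> too, so both closed half lines are free of sources and the Wronskians at the
      endpoints are those of true solutions.\<close>
    define G where "G = (\<lambda>x. indicat_real {a<..<b} x *\<^sub>R (cnj (snd (\<Phi> x)), cnj (fst (\<Phi> x))))"
    have nG: "(norm (G x))\<^sup>2 = indicat_real {a<..<b} x * (norm (\<Phi> x))\<^sup>2" for x
      by (simp add: G_def norm_prod_def indicator_def add.commute)
    have \<Phi>o: "set_integrable lborel {a<..<b} (\<lambda>x. (norm (\<Phi> x))\<^sup>2)"
      by (rule set_integrable_subset[OF \<Phi>i]) auto
    have H: "(\<lambda>x. (cnj (snd (\<Phi> x)), cnj (fst (\<Phi> x)))) \<in> borel_measurable borel"
      by (rule borel_measurable_continuous_onI) (intro continuous_intros c)
    have "G \<in> borel_measurable borel"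
      unfolding G_def by (intro borel_measurable_scaleR borel_measurable_indicator H) simp
    then have G2: "L2_on UNIV G"
      using \<Phi>o by (simp add: L2_on_def set_borel_measurable_def set_integrable_def nG)
    have "(L2norm G)\<^sup>2 = (LINT x:{a<..<b}|lborel. (norm (\<Phi> x))\<^sup>2)"
      by (simp add: L2norm_def nG set_lebesgue_integral_def)
    also have "\<dots> \<le> M"
      unfolding M_def by (rule set_integral_mono_set_nonneg[OF \<Phi>i]) auto
    finally have LG: "(L2norm G)\<^sup>2 \<le> M" .
    obtain F where F: "Dq_graph q F (\<lambda>x. G x + cscale z (F x))" using surj[OF G2] by blast
    have sF: "solves q z G F" by (rule Dq_graph_solves[OF F])
    have F2: "integrable lborel (\<lambda>x. (norm (F x))\<^sup>2)"
      using F by (simp add: Dq_graph_def L2_on_def set_integrable_def)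
    have FS: "set_integrable lborel S (\<lambda>x. (norm (F x))\<^sup>2)" if "S \<in> sets borel" for S
    proof (rule set_integrable_subset[of _ UNIV])
      show "set_integrable lborel UNIV (\<lambda>x. (norm (F x))\<^sup>2)"
        using F2 by (simp add: set_integrable_def)
    qed (use that in auto)
    have "L2norm F \<le> C0 * L2norm G" using bound[OF F] by simp
    moreover have "0 \<le> L2norm F" by (simp add: L2norm_def)
    ultimately have "(L2norm F)\<^sup>2 \<le> (C0 * L2norm G)\<^sup>2" by (rule power_mono)
    also have "\<dots> \<le> C0\<^sup>2 * M"
      unfolding power_mult_distrib by (intro mult_left_mono LG) simp
    finally have massF: "(LINT x|lborel. (norm (F x))\<^sup>2) \<le> C0\<^sup>2 * M"
      by (simp add: L2norm_def)
    have iv: "is_interval {..a}" "is_interval {b..}" by (rule is_interval_ic is_interval_ci)+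
    obtain \<Xi>m where \<Xi>m: "solution q z \<Xi>m" "\<And>x. x \<in> {..a} \<Longrightarrow> \<Xi>m x = F x"
      using solution_extension[OF q sF iv(1)] by (auto simp: G_def zero_prod_def)
    obtain \<Xi>p where \<Xi>p: "solution q z \<Xi>p" "\<And>x. x \<in> {b..} \<Longrightarrow> \<Xi>p x = F x"
      using solution_extension[OF q sF iv(2)] by (auto simp: G_def zero_prod_def)
    have green: "wronskian (\<Phi> b) (F b) - wronskian (\<Phi> a) (F a) = \<i> * of_real M"
    proof -
      have "((\<lambda>x. (norm (\<Phi> x))\<^sup>2) has_integral M) {a..b}"
        unfolding M_def using set_borel_integral_eq_integral[OF \<Phi>i] by (simp add: has_integral_iff)
      moreover have "bounded_linear (\<lambda>r. \<i> * of_real r)"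
        by (intro bounded_linear_const_mult bounded_linear_of_real)
      ultimately have "((\<lambda>x. \<i> * of_real ((norm (\<Phi> x))\<^sup>2)) has_integral \<i> * of_real M) {a..b}"
        using has_integral_linear[unfolded o_def] by blast
      \<comment> \<open>At the two endpoints the integrands may differ, since \<open>G\<close> is
        zero there; a finite set does not affect the integral.\<close>
      then have "((\<lambda>s. \<i> * (fst (\<Phi> s) * snd (G s) + snd (\<Phi> s) * fst (G s))) has_integral \<i> * of_real M) {a..b}"
      proof (rule has_integral_spike[rotated 2])
        show "negligible {a, b}" by simp
        fix s assume "s \<in> {a..b} - {a, b}"
        then show "\<i> * (fst (\<Phi> s) * snd (G s) + snd (\<Phi> s) * fst (G s)) = \<i> * of_real ((norm (\<Phi> s))\<^sup>2)"
          by (simp add: G_def norm_prod_def complex_norm_square[symmetric])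
      qed
      from has_integral_unique[OF wronskian_green[OF \<Phi> sF ab] this] show ?thesis .
    qed
    show "\<exists>\<Xi>m \<Xi>p. solution q z \<Xi>m \<and> solution q z \<Xi>p \<and>
     set_integrable lborel {..a} (\<lambda>x. (norm (\<Xi>m x))\<^sup>2) \<and> set_integrable lborel {b..} (\<lambda>x. (norm (\<Xi>p x))\<^sup>2) \<and>
     wronskian (\<Phi> b) (\<Xi>p b) - wronskian (\<Phi> a) (\<Xi>m a) = \<i> * of_real (LINT x:{a..b}|lborel. (norm (\<Phi> x))\<^sup>2) \<and>
     (LINT x:{b..}|lborel. (norm (\<Xi>p x))\<^sup>2) \<le> C0\<^sup>2 * (LINT x:{a..b}|lborel. (norm (\<Phi> x))\<^sup>2)"
    proof (rule exI[of _ \<Xi>m], rule exI[of _ \<Xi>p], intro conjI)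
      show "set_integrable lborel {..a} (\<lambda>x. (norm (\<Xi>m x))\<^sup>2)"
        using FS[of "{..a}"] \<Xi>m(2) by (subst set_integrable_cong[OF refl]) auto
      show "set_integrable lborel {b..} (\<lambda>x. (norm (\<Xi>p x))\<^sup>2)"
        using FS[of "{b..}"] \<Xi>p(2) by (subst set_integrable_cong[OF refl]) auto
      show "wronskian (\<Phi> b) (\<Xi>p b) - wronskian (\<Phi> a) (\<Xi>m a) = \<i> * of_real (LINT x:{a..b}|lborel. (norm (\<Phi> x))\<^sup>2)"
        using green \<Xi>m(2) \<Xi>p(2) by (simp add: M_def)
      have "(LINT x:{b..}|lborel. (norm (\<Xi>p x))\<^sup>2) = (LINT x:{b..}|lborel. (norm (F x))\<^sup>2)"
        using \<Xi>p(2) by (intro set_lebesgue_integral_cong) auto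
      also have "\<dots> \<le> (LINT x:UNIV|lborel. (norm (F x))\<^sup>2)"
        by (rule set_integral_mono_set_nonneg[OF FS]) auto
      also have "\<dots> \<le> C0\<^sup>2 * M" using massF by (simp add: set_lebesgue_integral_def)
      finally show "(LINT x:{b..}|lborel. (norm (\<Xi>p x))\<^sup>2) \<le> C0\<^sup>2 * (LINT x:{a..b}|lborel. (norm (\<Phi> x))\<^sup>2)"
        by (simp add: M_def)
    qed (use \<Xi>m \<Xi>p in auto)
  qed
qed

section \<open>Weyl solutions\<close>

text \<open>Cauchy-Schwarz for the moduli of the components, obtained from Lagrange's
  identity.\<close>

lemma norm_wronskian_le: "norm (wronskian u v) \<le> norm u * norm v"
proof -
  define a b c d where "a = norm (fst u)" "b = norm (snd u)" "c = norm (fst v)" "d = norm (snd v)"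
  have "norm (wronskian u v) \<le> a * d + b * c"
    unfolding wronskian_def a_b_c_d_def norm_mult[symmetric] by (rule norm_triangle_ineq4)
  also have "\<dots> \<le> sqrt ((a\<^sup>2 + b\<^sup>2) * (c\<^sup>2 + d\<^sup>2))"
  proof (rule real_le_rsqrt)
    have "(a * d + b * c)\<^sup>2 + (a * c - b * d)\<^sup>2 = (a\<^sup>2 + b\<^sup>2) * (c\<^sup>2 + d\<^sup>2)"
      by (simp add: power2_eq_square algebra_simps)
    then show "(a * d + b * c)\<^sup>2 \<le> (a\<^sup>2 + b\<^sup>2) * (c\<^sup>2 + d\<^sup>2)"
      using zero_le_power2[of "a * c - b * d"] by linarith
  qed
  also have "\<dots> = norm u * norm v"
    by (simp add: norm_prod_def real_sqrt_mult a_b_c_d_def)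
  finally show ?thesis .
qed

lemma solution_wronskian_constant:
  assumes "solution q z \<Phi>" "solution q z \<Psi>"
  shows "wronskian (\<Phi> x) (\<Psi> x) = wronskian (\<Phi> y) (\<Psi> y)"
  using wronskian_constant[OF assms is_interval_univ] by simp

text \<open>A constant that is bounded by a product tending to zero must vanish. An arbitrary
  nontrivial filter covers both ends at once.\<close>

lemma decaying_solutions_wronskian:
  assumes "solution q z \<Phi>" "solution q z \<Psi>" "F \<noteq> bot"
    and "((\<lambda>x. norm (\<Phi> x)) \<longlongrightarrow> 0) F" "((\<lambda>x. norm (\<Psi> x)) \<longlongrightarrow> 0) F"
  shows "wronskian (\<Phi> x) (\<Psi> x) = 0"
proof -
  have "((\<lambda>x. norm (\<Phi> x) * norm (\<Psi> x)) \<longlongrightarrow> 0) F"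
    using tendsto_mult[OF assms(4,5)] by simp
  moreover have "norm (wronskian (\<Phi> x) (\<Psi> x)) \<le> norm (\<Phi> y) * norm (\<Psi> y)" for y
    using norm_wronskian_le[of "\<Phi> y" "\<Psi> y"] solution_wronskian_constant[OF assms(1,2), of x y] by simp
  ultimately have "norm (wronskian (\<Phi> x) (\<Psi> x)) \<le> 0"
    using assms(3) by (intro tendsto_lowerbound[of _ 0 F]) auto
  then show ?thesis by simp
qed

lemma wronskian_cscale_right: "wronskian u (cscale c v) = c * wronskian u v"
  by (simp add: wronskian_def cscale_def algebra_simps)

lemma L2_on_iff:
  assumes "continuous_on UNIV F" "S \<in> sets borel"
  shows "L2_on S F \<longleftrightarrow> set_integrable lborel S (\<lambda>x. (norm (F x))\<^sup>2)"
proof -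
  have "F \<in> borel_measurable borel" by (rule borel_measurable_continuous_onI[OF assms(1)])
  then have "(\<lambda>x. indicator S x *\<^sub>R F x) \<in> borel_measurable borel"
    by (intro borel_measurable_scaleR borel_measurable_indicator assms(2))
  then show ?thesis by (simp add: L2_on_def set_borel_measurable_def)
qed

text \<open>This converts decay and integrability of one solution into growth of the other, and so
  yields every property of the reciprocal norms.\<close>

lemma inverse_norm_le:
  assumes "wronskian u v = W" "W \<noteq> 0"
  shows "inverse (norm u) \<le> norm v / norm W"
proof -
  have "norm W \<le> norm u * norm v" using norm_wronskian_le[of u v] assms by simp
  moreover have "u \<noteq> 0" using assms by (auto simp: wronskian_def)
  ultimately show ?thesis using assms(2) by (simp add: field_simps)
qed

lemma set_integrable_inverse_norm:
  assumes \<Phi>: "continuous_on UNIV \<Phi>" and \<Psi>: "set_integrable lborel S (\<lambda>x. (norm (\<Psi> x))\<^sup>2)"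
    and S: "S \<in> sets borel" and W: "\<And>x. wronskian (\<Phi> x) (\<Psi> x) = W" "W \<noteq> 0"
  shows "set_integrable lborel S (\<lambda>x. (inverse (norm (\<Phi> x)))\<^sup>2)"
proof (rule set_integrable_bound)
  show "set_integrable lborel S (\<lambda>x. (norm (\<Psi> x))\<^sup>2 / (norm W)\<^sup>2)"
    by (rule set_integrable_divide) (rule \<Psi>)
  have "\<Phi> x \<noteq> 0" for x using W(1)[of x] W(2) by (auto simp: wronskian_def)
  then have "(\<lambda>x. (inverse (norm (\<Phi> x)))\<^sup>2) \<in> borel_measurable borel"
    by (intro borel_measurable_continuous_onI continuous_intros \<Phi>) auto
  then show "set_borel_measurable lborel S (\<lambda>x. (inverse (norm (\<Phi> x)))\<^sup>2)"
    unfolding set_borel_measurable_def using S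
    by (intro borel_measurable_scaleR borel_measurable_indicator) auto
  show "AE x in lborel. x \<in> S \<longrightarrow> norm ((inverse (norm (\<Phi> x)))\<^sup>2) \<le> norm ((norm (\<Psi> x))\<^sup>2 / (norm W)\<^sup>2)"
    using inverse_norm_le[OF W] by (auto simp: power_divide[symmetric] intro!: power_mono)
qed

lemma tendsto_inverse_norm:
  assumes "((\<lambda>x. norm (\<Psi> x)) \<longlongrightarrow> 0) F" and W: "\<And>x. wronskian (\<Phi> x) (\<Psi> x) = W" "W \<noteq> 0"
  shows "((\<lambda>x. inverse (norm (\<Phi> x))) \<longlongrightarrow> 0) F"
proof (rule tendsto_sandwich[OF _ _ tendsto_const])
  show "((\<lambda>x. norm (\<Psi> x) / norm W) \<longlongrightarrow> 0) F"
    using tendsto_divide[OF assms(1) tendsto_const, of "norm W"] W(2) by simp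
  show "\<forall>\<^sub>F x in F. inverse (norm (\<Phi> x)) \<le> norm (\<Psi> x) / norm W"
    using inverse_norm_le[OF W] by simp
qed simp

text \<open>A criterion in terms of the two functions alone, so that it serves for \<open>z\<close>
  and, after \<open>Kop\<close>, for \<open>cnj z\<close>. Uniqueness up to multiples follows since
  two solutions decaying at the same end have Wronskian zero.\<close>

lemma weyl_pairI:
  assumes q: "L1_loc q" and m: "wave_function q z \<Psi>m" and p: "wave_function q z \<Psi>p"
    and mi: "set_integrable lborel {..0} (\<lambda>x. (norm (\<Psi>m x))\<^sup>2)"
    and pi: "set_integrable lborel {0..} (\<lambda>x. (norm (\<Psi>p x))\<^sup>2)"
    and W0: "wronskian (\<Psi>m 0) (\<Psi>p 0) \<noteq> 0"
    and bound: "\<And>r. (LINT x:{..r}|lborel. (norm (\<Psi>m x))\<^sup>2) * (LINT x:{r..}|lborel. (norm (\<Psi>p x))\<^sup>2) \<le> C"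
  shows "weyl_pair q z \<Psi>m \<Psi>p"
proof -
  define W where "W = wronskian (\<Psi>m 0) (\<Psi>p 0)"
  have sm: "solution q z \<Psi>m" and sp: "solution q z \<Psi>p" using m p by (auto simp: wave_function_iff)
  note cm = solves_continuous[OF sm] and cp = solves_continuous[OF sp]
  have W: "wronskian (\<Psi>m x) (\<Psi>p x) = W" "W \<noteq> 0" for x
    using solution_wronskian_constant[OF sm sp, of x 0] W0 by (auto simp: W_def)
  have W': "wronskian (\<Psi>p x) (\<Psi>m x) = - W" "- W \<noteq> 0" for x
    using W(1)[of x] W(2) wronskian_commute[of "\<Psi>p x"] by auto
  have mi': "set_integrable lborel {..R} (\<lambda>x. (norm (\<Psi>m x))\<^sup>2)" for R
    by (rule set_integrable_left_tail[OF cm mi])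
  have pi': "set_integrable lborel {R..} (\<lambda>x. (norm (\<Psi>p x))\<^sup>2)" for R
    by (rule set_integrable_right_tail[OF cp pi])
  note dm = solution_tendsto_zero_at_bot[OF sm mi] and dp = solution_tendsto_zero_at_top[OF sp pi]
  have indep: "a = 0 \<and> b = 0" if "\<forall>x. a * fst (\<Psi>m x) + b * fst (\<Psi>p x) = 0 \<and> a * snd (\<Psi>m x) + b * snd (\<Psi>p x) = 0" for a b
  proof -
    have 1: "a * fst (\<Psi>m 0) = - (b * fst (\<Psi>p 0))" "a * snd (\<Psi>m 0) = - (b * snd (\<Psi>p 0))"
      using that by (auto simp: eq_neg_iff_add_eq_0)
    have 2: "b * fst (\<Psi>p 0) = - (a * fst (\<Psi>m 0))" "b * snd (\<Psi>p 0) = - (a * snd (\<Psi>m 0))"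
      using 1 by auto
    \<comment> \<open>Multiplying the determinant by one coefficient lets the linear relation turn
      it into a determinant with proportional columns.\<close>
    have "a * W = (a * fst (\<Psi>m 0)) * snd (\<Psi>p 0) - (a * snd (\<Psi>m 0)) * fst (\<Psi>p 0)"
      by (simp add: W_def wronskian_def algebra_simps)
    also have "\<dots> = 0" unfolding 1 by (simp add: algebra_simps)
    finally have "a * W = 0" .
    moreover have "b * W = fst (\<Psi>m 0) * (b * snd (\<Psi>p 0)) - snd (\<Psi>m 0) * (b * fst (\<Psi>p 0))"
      by (simp add: W_def wronskian_def algebra_simps)
    then have "b * W = 0" unfolding 2 by (simp add: algebra_simps)
    ultimately have "a * W = 0" "b * W = 0" by auto
    then show ?thesis using W(2) by simp
  qed
  have um: "\<exists>c. \<forall>x. \<Phi> x = cscale c (\<Psi>m x)" if "wave_function q z \<Phi>" "\<forall>R. L2_on {..R} \<Phi>" for \<Phi>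
  proof -
    have s: "solution q z \<Phi>" using that(1) by (simp add: wave_function_iff)
    have "set_integrable lborel {..0} (\<lambda>x. (norm (\<Phi> x))\<^sup>2)" using that(2) by (simp add: L2_on_def)
    then have "wronskian (\<Psi>m 0) (\<Phi> 0) = 0"
      by (intro decaying_solutions_wronskian[OF sm s _ dm] solution_tendsto_zero_at_bot[OF s]) auto
    from solution_proportional[OF q m s this] show ?thesis by metis
  qed
  have up: "\<exists>c. \<forall>x. \<Phi> x = cscale c (\<Psi>p x)" if "wave_function q z \<Phi>" "\<forall>R. L2_on {R..} \<Phi>" for \<Phi>
  proof -
    have s: "solution q z \<Phi>" using that(1) by (simp add: wave_function_iff)
    have "set_integrable lborel {0..} (\<lambda>x. (norm (\<Phi> x))\<^sup>2)" using that(2) by (simp add: L2_on_def)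
    then have "wronskian (\<Psi>p 0) (\<Phi> 0) = 0"
      by (intro decaying_solutions_wronskian[OF sp s _ dp] solution_tendsto_zero_at_top[OF s]) auto
    from solution_proportional[OF q p s this] show ?thesis by metis
  qed
  show ?thesis
    unfolding weyl_pair_def
  proof (intro conjI allI impI)
    show "L2_on {..R} \<Psi>m" "L2_on {R..} \<Psi>p" for R
      using mi' pi' by (simp_all add: L2_on_iff cm cp)
    show "set_integrable lborel {R..} (\<lambda>x. (inverse (norm (\<Psi>m x)))\<^sup>2)" for R
      by (rule set_integrable_inverse_norm[OF cm pi' _ W]) simp
    show "set_integrable lborel {..R} (\<lambda>x. (inverse (norm (\<Psi>p x)))\<^sup>2)" for R
      by (rule set_integrable_inverse_norm[OF cp mi' _ W']) simp
    show "((\<lambda>x. inverse (norm (\<Psi>p x))) \<longlongrightarrow> 0) at_bot"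
      by (rule tendsto_inverse_norm[OF dm W'])
    show "((\<lambda>x. inverse (norm (\<Psi>m x))) \<longlongrightarrow> 0) at_top"
      by (rule tendsto_inverse_norm[OF dp W])
    show "\<exists>C. \<forall>r. (LINT x:{..r}|lborel. (norm (\<Psi>m x))\<^sup>2) * (LINT x:{r..}|lborel. (norm (\<Psi>p x))\<^sup>2) \<le> C"
      using bound by blast
  qed (use m p dm dp indep um up in \<open>blast+\<close>)
qed

section \<open>The conjugation \<open>Kop\<close>\<close>

lemma norm_Kop: "norm (Kop v) = norm v"
  by (simp add: Kop_def norm_prod_def add.commute)

lemma wronskian_Kop: "wronskian (Kop u) (Kop v) = cnj (wronskian u v)"
  by (simp add: wronskian_def Kop_def)

lemma wave_function_Kop:
  assumes "wave_function q z \<Psi>"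
  shows "wave_function q (cnj z) (\<lambda>x. Kop (\<Psi> x))"
proof -
  \<comment> \<open>Linearity is over the reals here, so the conjugate-linear map \<open>Kop\<close>
    qualifies and commutes with the derivative in \<open>x\<close>.\<close>
  have bl: "bounded_linear Kop"
    unfolding Kop_def
    by (intro bounded_linear_Pair bounded_linear_minus bounded_linear_compose[OF bounded_linear_cnj]
        bounded_linear_fst bounded_linear_snd)
  have "AE x in lborel. ((\<lambda>x. Kop (\<Psi> x)) has_vector_derivative
        (- \<i> * cnj z * fst (Kop (\<Psi> x)) + q x * snd (Kop (\<Psi> x)),
         \<i> * cnj z * snd (Kop (\<Psi> x)) - cnj (q x) * fst (Kop (\<Psi> x)))) (at x)"
    using assms[unfolded wave_function_def, THEN conjunct2, THEN conjunct2]
  proof eventually_elim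
    case (elim x)
    show ?case
      by (rule has_vector_derivative_eq_rhs, rule bounded_linear.has_vector_derivative[OF bl elim])
         (simp add: Kop_def)
  qed
  moreover have "AC_loc (\<lambda>x. Kop (\<Psi> x))"
    using assms by (intro AC_loc_bounded_linear[OF _ bl]) (simp add: wave_function_def)
  moreover have "\<exists>x. Kop (\<Psi> x) \<noteq> 0"
    using assms norm_Kop unfolding wave_function_def by (metis norm_eq_zero)
  ultimately show ?thesis by (simp add: wave_function_def)
qed

section \<open>Square integrable wave functions at each end\<close>

lemma wave_function_exists:
  assumes "L1_loc q"
  obtains \<Phi> where "wave_function q z \<Phi>"
proof -
  obtain E1 E2 where "solution q z E1" "\<And>x. wronskian (E1 x) (E2 x) = 1"
    using fundamental_system[OF assms] by blast
  then have "wave_function q z E1"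
    unfolding wave_function_iff by (auto simp: wronskian_def intro!: exI[of _ 0]) (metis fst_zero snd_zero mult_zero_left diff_zero zero_neq_one)
  then show thesis by (rule that)
qed

text \<open>If no wave function were square integrable at \<open>+\<infinity>\<close>, every response would vanish to the right of
  its source, and two applications of the resolvent would give two solutions that decay
  at \<open>-\<infinity>\<close> and have a nonzero Wronskian. The other end is symmetric.\<close>
lemma right_wave_function_exists:
  assumes q: "L1_loc q" and z: "z \<in> resolvent_set_Dq q"
  shows "\<exists>\<Psi>. wave_function q z \<Psi> \<and> set_integrable lborel {1..} (\<lambda>x. (norm (\<Psi> x))\<^sup>2)"
proof (rule ccontr)
  assume "\<nexists>\<Psi>. wave_function q z \<Psi> \<and> set_integrable lborel {1..} (\<lambda>x. (norm (\<Psi> x))\<^sup>2)"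
  then have no: "\<not> wave_function q z \<Psi>" if "set_integrable lborel {1..} (\<lambda>x. (norm (\<Psi> x))\<^sup>2)" for \<Psi>
    using that by blast
  have step: "\<exists>\<Xi>. wave_function q z \<Xi> \<and> set_integrable lborel {..0} (\<lambda>x. (norm (\<Xi> x))\<^sup>2) \<and> wronskian (\<Phi> 0) (\<Xi> 0) \<noteq> 0"
    if \<Phi>: "wave_function q z \<Phi>" for \<Phi>
  proof -
    have "solution q z \<Phi>" using \<Phi> by (simp add: wave_function_iff)
    then obtain \<Xi>m \<Xi>p where \<Xi>: "solution q z \<Xi>m" "solution q z \<Xi>p"
      "set_integrable lborel {..0} (\<lambda>x. (norm (\<Xi>m x))\<^sup>2)" "set_integrable lborel {1..} (\<lambda>x. (norm (\<Xi>p x))\<^sup>2)"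
      and w: "wronskian (\<Phi> 1) (\<Xi>p 1) - wronskian (\<Phi> 0) (\<Xi>m 0) = \<i> * of_real (LINT x:{0..1}|lborel. (norm (\<Phi> x))\<^sup>2)"
      using resolvent_response[OF q z] by (metis zero_le_one)
    \<comment> \<open>If \<open>\<Xi>p\<close> were nonzero here it would be a wave function of the
      excluded kind; so the whole right-hand side of Green's formula sits at the left
      endpoint.\<close>
    have "\<Xi>p 1 = 0" using no[OF \<Xi>(4)] \<Xi>(2) by (auto simp: wave_function_iff)
    then have "wronskian (\<Phi> 0) (\<Xi>m 0) \<noteq> 0"
      using w wave_function_mass_pos[OF q \<Phi>] by (auto simp: wronskian_def)
    moreover from this have "\<Xi>m 0 \<noteq> 0" by (auto simp: wronskian_def)
    ultimately show ?thesis using \<Xi> by (auto simp: wave_function_iff)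
  qed
  obtain \<Phi> where "wave_function q z \<Phi>" using wave_function_exists[OF q] by blast
  then obtain \<Xi> where \<Xi>: "wave_function q z \<Xi>" "set_integrable lborel {..0} (\<lambda>x. (norm (\<Xi> x))\<^sup>2)"
    using step by blast
  then obtain \<Xi>' where \<Xi>': "wave_function q z \<Xi>'" "set_integrable lborel {..0} (\<lambda>x. (norm (\<Xi>' x))\<^sup>2)"
    "wronskian (\<Xi> 0) (\<Xi>' 0) \<noteq> 0"
    using step by blast
  have s: "solution q z \<Xi>" "solution q z \<Xi>'" using \<Xi> \<Xi>' by (auto simp: wave_function_iff)
  from decaying_solutions_wronskian[OF s _ solution_tendsto_zero_at_bot[OF s(1) \<Xi>(2)] solution_tendsto_zero_at_bot[OF s(2) \<Xi>'(2)]]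
  show False using \<Xi>'(3) by simp
qed

lemma left_wave_function_exists:
  assumes q: "L1_loc q" and z: "z \<in> resolvent_set_Dq q"
  shows "\<exists>\<Psi>. wave_function q z \<Psi> \<and> set_integrable lborel {..0} (\<lambda>x. (norm (\<Psi> x))\<^sup>2)"
proof (rule ccontr)
  assume "\<nexists>\<Psi>. wave_function q z \<Psi> \<and> set_integrable lborel {..0} (\<lambda>x. (norm (\<Psi> x))\<^sup>2)"
  then have no: "\<not> wave_function q z \<Psi>" if "set_integrable lborel {..0} (\<lambda>x. (norm (\<Psi> x))\<^sup>2)" for \<Psi>
    using that by blast
  have step: "\<exists>\<Xi>. wave_function q z \<Xi> \<and> set_integrable lborel {1..} (\<lambda>x. (norm (\<Xi> x))\<^sup>2) \<and> wronskian (\<Phi> 1) (\<Xi> 1) \<noteq> 0"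
    if \<Phi>: "wave_function q z \<Phi>" for \<Phi>
  proof -
    have "solution q z \<Phi>" using \<Phi> by (simp add: wave_function_iff)
    then obtain \<Xi>m \<Xi>p where \<Xi>: "solution q z \<Xi>m" "solution q z \<Xi>p"
      "set_integrable lborel {..0} (\<lambda>x. (norm (\<Xi>m x))\<^sup>2)" "set_integrable lborel {1..} (\<lambda>x. (norm (\<Xi>p x))\<^sup>2)"
      and w: "wronskian (\<Phi> 1) (\<Xi>p 1) - wronskian (\<Phi> 0) (\<Xi>m 0) = \<i> * of_real (LINT x:{0..1}|lborel. (norm (\<Phi> x))\<^sup>2)"
      using resolvent_response[OF q z] by (metis zero_le_one)
    have "\<Xi>m 0 = 0" using no[OF \<Xi>(3)] \<Xi>(1) by (auto simp: wave_function_iff)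
    then have "wronskian (\<Phi> 1) (\<Xi>p 1) \<noteq> 0"
      using w wave_function_mass_pos[OF q \<Phi>] by (auto simp: wronskian_def)
    moreover from this have "\<Xi>p 1 \<noteq> 0" by (auto simp: wronskian_def)
    ultimately show ?thesis using \<Xi> by (auto simp: wave_function_iff)
  qed
  obtain \<Phi> where "wave_function q z \<Phi>" using wave_function_exists[OF q] by blast
  then obtain \<Xi> where \<Xi>: "wave_function q z \<Xi>" "set_integrable lborel {1..} (\<lambda>x. (norm (\<Xi> x))\<^sup>2)"
    using step by blast
  then obtain \<Xi>' where \<Xi>': "wave_function q z \<Xi>'" "set_integrable lborel {1..} (\<lambda>x. (norm (\<Xi>' x))\<^sup>2)"
    "wronskian (\<Xi> 1) (\<Xi>' 1) \<noteq> 0"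
    using step by blast
  have s: "solution q z \<Xi>" "solution q z \<Xi>'" using \<Xi> \<Xi>' by (auto simp: wave_function_iff)
  from decaying_solutions_wronskian[OF s _ solution_tendsto_zero_at_top[OF s(1) \<Xi>(2)] solution_tendsto_zero_at_top[OF s(2) \<Xi>'(2)]]
  show False using \<Xi>'(3) by simp
qed

text \<open>Such a function would be an eigenfunction of D(q) for \<open>z\<close>. Injectivity
  makes it zero almost everywhere, although a wave function has no zeros.\<close>

lemma no_square_integrable_wave_function:
  assumes q: "L1_loc q" and z: "z \<in> resolvent_set_Dq q" and \<Psi>: "wave_function q z \<Psi>"
    and "set_integrable lborel {..0} (\<lambda>x. (norm (\<Psi> x))\<^sup>2)" "set_integrable lborel {0..} (\<lambda>x. (norm (\<Psi> x))\<^sup>2)"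
  shows False
proof -
  have s: "solution q z \<Psi>" using \<Psi> by (simp add: wave_function_iff)
  have "set_integrable lborel ({..0} \<union> {0..}) (\<lambda>x. (norm (\<Psi> x))\<^sup>2)"
    by (rule set_integrable_Un[OF assms(4,5)]) auto
  then have "set_integrable lborel UNIV (\<lambda>x. (norm (\<Psi> x))\<^sup>2)"
    by (rule set_integrable_subset) auto
  then have "L2_on UNIV \<Psi>" by (simp add: L2_on_iff solves_continuous[OF s])
  from solution_imp_Dq_graph[OF s this] z have "AE x in lborel. \<Psi> x = 0"
    unfolding resolvent_set_Dq_def by blast
  then have "AE x::real in lborel. False"
    using solution_nonzero[OF q \<Psi>] by simp
  then show False by (simp add: eventually_False ae_filter_eq_bot_iff)
qed

theorem theorem5p4:
  fixes q :: "real \<Rightarrow> complex" and z :: complex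
  assumes "L1_loc q"
    and "resolvent_set_Dq q \<noteq> {}"
    and "z \<in> resolvent_set_Dq q"
  shows "\<exists>\<Psi>m \<Psi>p. weyl_pair q z \<Psi>m \<Psi>p \<and>
           weyl_pair q (cnj z) (\<lambda>x. Kop (\<Psi>m x)) (\<lambda>x. Kop (\<Psi>p x))"
proof -
  note q = assms(1) and z = assms(3)
  obtain \<Psi>m where m: "wave_function q z \<Psi>m" and mi: "set_integrable lborel {..0} (\<lambda>x. (norm (\<Psi>m x))\<^sup>2)"
    using left_wave_function_exists[OF q z] by blast
  obtain \<Psi>p where p: "wave_function q z \<Psi>p" and p1: "set_integrable lborel {1..} (\<lambda>x. (norm (\<Psi>p x))\<^sup>2)"
    using right_wave_function_exists[OF q z] by blast
  have sm: "solution q z \<Psi>m" and sp: "solution q z \<Psi>p" using m p by (auto simp: wave_function_iff)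
  note cm = solves_continuous[OF sm] and cp = solves_continuous[OF sp]
  have pi: "set_integrable lborel {0..} (\<lambda>x. (norm (\<Psi>p x))\<^sup>2)"
    by (rule set_integrable_right_tail[OF cp p1])
  note dm = solution_tendsto_zero_at_bot[OF sm mi] and dp = solution_tendsto_zero_at_top[OF sp pi]
  define W where "W = wronskian (\<Psi>m 0) (\<Psi>p 0)"
  have W0: "W \<noteq> 0"
  proof
    assume "W = 0"
    \<comment> \<open>Proportionality would make \<open>\<Psi>p\<close> square integrable at both
      ends.\<close>
    then obtain c where c: "\<And>y. \<Psi>p y = cscale c (\<Psi>m y)"
      using solution_proportional[OF q m sp] unfolding W_def by metis
    have "set_integrable lborel {..0} (\<lambda>x. (norm c)\<^sup>2 * (norm (\<Psi>m x))\<^sup>2)"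
      by (rule set_integrable_mult_right) (rule mi)
    then have "set_integrable lborel {..0} (\<lambda>x. (norm (\<Psi>p x))\<^sup>2)"
      by (simp add: c norm_cscale power_mult_distrib)
    then show False using no_square_integrable_wave_function[OF q z p _ pi] by blast
  qed
  have W: "wronskian (\<Psi>m x) (\<Psi>p x) = W" for x
    using solution_wronskian_constant[OF sm sp, of x 0] by (simp add: W_def)
  obtain C where C: "\<And>\<Phi> a b. \<lbrakk>solution q z \<Phi>; a \<le> b\<rbrakk> \<Longrightarrow> \<exists>\<Xi>m \<Xi>p. solution q z \<Xi>m \<and> solution q z \<Xi>p \<and>
     set_integrable lborel {..a} (\<lambda>x. (norm (\<Xi>m x))\<^sup>2) \<and> set_integrable lborel {b..} (\<lambda>x. (norm (\<Xi>p x))\<^sup>2) \<and>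
     wronskian (\<Phi> b) (\<Xi>p b) - wronskian (\<Phi> a) (\<Xi>m a) = \<i> * of_real (LINT x:{a..b}|lborel. (norm (\<Phi> x))\<^sup>2) \<and>
     (LINT x:{b..}|lborel. (norm (\<Xi>p x))\<^sup>2) \<le> C * (LINT x:{a..b}|lborel. (norm (\<Phi> x))\<^sup>2)"
    using resolvent_response[OF q z] by blast
  have finite_bound: "(LINT x:{a..r}|lborel. (norm (\<Psi>m x))\<^sup>2) * (LINT x:{r..}|lborel. (norm (\<Psi>p x))\<^sup>2) \<le> \<bar>C\<bar> * (norm W)\<^sup>2"
    if ar: "a \<le> r" for a r
  proof -
    define M where "M = (LINT x:{a..r}|lborel. (norm (\<Psi>m x))\<^sup>2)"
    define P where "P = (LINT x:{r..}|lborel. (norm (\<Psi>p x))\<^sup>2)"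
    have M0: "0 \<le> M" unfolding M_def set_lebesgue_integral_def by (rule Bochner_Integration.integral_nonneg) simp
    obtain \<Xi>m \<Xi>p where \<Xi>: "solution q z \<Xi>m" "solution q z \<Xi>p"
      "set_integrable lborel {..a} (\<lambda>x. (norm (\<Xi>m x))\<^sup>2)" "set_integrable lborel {r..} (\<lambda>x. (norm (\<Xi>p x))\<^sup>2)"
      and w: "wronskian (\<Psi>m r) (\<Xi>p r) - wronskian (\<Psi>m a) (\<Xi>m a) = \<i> * of_real M"
      and le: "(LINT x:{r..}|lborel. (norm (\<Xi>p x))\<^sup>2) \<le> C * M"
      using C[OF sm ar] unfolding M_def by blast
    \<comment> \<open>Both solutions decay at minus infinity, which removes the boundary term at
      \<open>a\<close>; at the other end decay makes \<open>\<Xi>p\<close> a multiple of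
      \<open>\<Psi>p\<close>.\<close>
    have "wronskian (\<Psi>m a) (\<Xi>m a) = 0"
      by (rule decaying_solutions_wronskian[OF sm \<Xi>(1) _ dm solution_tendsto_zero_at_bot[OF \<Xi>(1,3)]]) simp
    moreover have "wronskian (\<Psi>p 0) (\<Xi>p 0) = 0"
      by (rule decaying_solutions_wronskian[OF sp \<Xi>(2) _ dp solution_tendsto_zero_at_top[OF \<Xi>(2,4)]]) simp
    then obtain c where c: "\<And>y. \<Xi>p y = cscale c (\<Psi>p y)"
      using solution_proportional[OF q p \<Xi>(2)] by metis
    ultimately have "c * W = \<i> * of_real M"
      using w by (simp add: wronskian_cscale_right W)
    then have "norm (c * W) = norm (\<i> * complex_of_real M)" by simp
    then have cW: "norm c * norm W = M" using M0 by (simp add: norm_mult)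
    have "(norm c)\<^sup>2 * P \<le> C * M"
      using le by (simp add: c norm_cscale power_mult_distrib P_def)
    then have "(norm W)\<^sup>2 * ((norm c)\<^sup>2 * P) \<le> (norm W)\<^sup>2 * (\<bar>C\<bar> * M)"
      using M0 by (intro mult_left_mono order_trans[OF _ mult_right_mono[OF abs_ge_self]]) auto
    \<comment> \<open>Green's formula gives \<open>norm c * norm W = M\<close>, so the response mass
      on the right of \<open>r\<close> is quadratic in \<open>M\<close> while its resolvent bound is
      linear; one factor \<open>M\<close> cancels.\<close>
    moreover have "M * (M * P) = (norm W)\<^sup>2 * ((norm c)\<^sup>2 * P)"
      by (simp add: cW[symmetric] power2_eq_square algebra_simps)
    moreover have "(norm W)\<^sup>2 * (\<bar>C\<bar> * M) = M * (\<bar>C\<bar> * (norm W)\<^sup>2)" by simp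
    ultimately have "M * (M * P) \<le> M * (\<bar>C\<bar> * (norm W)\<^sup>2)" by (simp only:)
    \<comment> \<open>When \<open>M = 0\<close> there is nothing to cancel, and the absolute value
      of \<open>C\<close> keeps the right-hand side nonnegative.\<close>
    then have "M * P \<le> \<bar>C\<bar> * (norm W)\<^sup>2"
      using M0 by (cases "M = 0") (auto simp: mult_le_cancel_left)
    then show ?thesis by (simp add: M_def P_def)
  qed
  \<comment> \<open>The bound is uniform in the left endpoint \<open>a\<close>, so it survives the
    limit at minus infinity.\<close>
  have bound: "(LINT x:{..r}|lborel. (norm (\<Psi>m x))\<^sup>2) * (LINT x:{r..}|lborel. (norm (\<Psi>p x))\<^sup>2) \<le> \<bar>C\<bar> * (norm W)\<^sup>2" for r
  proof (rule tendsto_upperbound)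
    show "((\<lambda>a. (LINT x:{a..r}|lborel. (norm (\<Psi>m x))\<^sup>2) * (LINT x:{r..}|lborel. (norm (\<Psi>p x))\<^sup>2))
      \<longlongrightarrow> (LINT x:{..r}|lborel. (norm (\<Psi>m x))\<^sup>2) * (LINT x:{r..}|lborel. (norm (\<Psi>p x))\<^sup>2)) at_bot"
      by (intro tendsto_mult_right tendsto_set_lebesgue_integral_at_bot set_integrable_left_tail[OF cm mi]) simp
    show "\<forall>\<^sub>F a in at_bot. (LINT x:{a..r}|lborel. (norm (\<Psi>m x))\<^sup>2) * (LINT x:{r..}|lborel. (norm (\<Psi>p x))\<^sup>2) \<le> \<bar>C\<bar> * (norm W)\<^sup>2"
      using eventually_le_at_bot[of r] by eventually_elim (rule finite_bound)
  qed simp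
  have "weyl_pair q z \<Psi>m \<Psi>p"
    using W0 bound unfolding W_def by (intro weyl_pairI[OF q m p mi pi])
  moreover have "weyl_pair q (cnj z) (\<lambda>x. Kop (\<Psi>m x)) (\<lambda>x. Kop (\<Psi>p x))"
    using W0 bound mi pi unfolding W_def
    by (intro weyl_pairI[OF q wave_function_Kop[OF m] wave_function_Kop[OF p]])
       (simp_all add: norm_Kop wronskian_Kop)
  ultimately show ?thesis by blast
qed

end
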